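(* Let $S$ and $U$ be finite matrix sets. The following procedure terminates after finitely many steps and correctly decides whether $\mathsf{mclex}\,S\subseteq\mathsf{mclex}\,U$ (positive decision meaning that the inclusion holds, negative decision that it does not). Step 0. If $S$ contains an empty matrix, terminate with positive decision. Otherwise, if $U$ contains an empty matrix, terminate with negative decision. Step 1. If $S$ contains a matrix having a row with no entry $0$, terminate with positive decision. Otherwise, for each matrix $M\in S$, each pair of distinct rows of $M$ and an arbitrarily chosen entry $0$ in the first of these rows: if the second row does not contain an entry $0$ whose position is connected by a linkage in $M$ with the position of the chosen entry $0$ in the first row, terminate with positive decision. Step 2. For each matrix $N\in\mathsf{matr}(n,m,k)$ in $U$: keep expanding $N$, until it is impossible to expand it further, by adjoining as new columns the right columns of those row-wise interpretations $B$ of type $(\{0,\dots,k-1\},\dots,\{0,\dots,k-1\})$ of matrices $M'\in\mathsf{matr}(n,m',k')$ all of whose rows are rows of a common matrix $M\in S\cap \mathsf{matr}(n',m',k')$ (for some $n'$), such that all left columns of $B$, but not its right column, are among the columns of the current (expanded) $N$. If the final expanded $N$ does not contain the column consisting only of $0$'s, terminate with negative decision. Step 3. If the process was not terminated in the previous steps, conclude with positive decision.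
   Context: Matrices. For integers $n,k>0$ and $m\geqslant 0$, $\mathsf{matr}(n,m,k)$ is the set of $n\times m$ matrices with entries in $\{0,\dots,k-1\}$ ($m=0$ is allowed; such matrices are called empty). A matrix set is a subset of $\bigcup_{n>0,m\geqslant 0,k>0}\mathsf{matr}(n,m,k)$. Interpretations. A row-wise interpretation of $M=[a_{ij}]\in\mathsf{matr}(n,m,k)$ of type $(S_1,\dots,S_n)$ (sets) is given by functions $f_i\colon\{0,\dots,k-1\}\to S_i$ ($1\leqslant i\leqslant n$); it is the $n\times m$ matrix $[f_i(a_{ij})]$, whose columns are called left columns, extended by the right column $(f_1(0),\dots,f_n(0))$. An interpretation of $M$ of type $S$ is a row-wise interpretation of type $(S,\dots,S)$ with $f_1=\dots=f_n$. Closedness in categories. An internal $n$-ary relation on an object $C$ of a category $\mathbb{C}$ is an object $R$ with jointly monic morphisms $r_1,\dots,r_n\colon R\to C$. An element $(g_1,\dots,g_n)$ of $\mathbb{C}(X,C)^n$ belongs to the relation (over $X$) if there is $u\colon X\to R$ with $r_iu=g_i$ for all $i$. For $M$ with $n$ rows, the relation is $M$-closed if for every object $X$ and every interpretation of $M$ of type $\mathbb{C}(X,C)$ all of whose left columns belong to the relation over $X$, the right column also belongs to the relation over $X$. A category has $M$-closed relations if every internal $n$-ary relation on any object in it is $M$-closed. $\mathsf{mclex}\,S$ is the collection of all finitely complete categories having $M$-closed relations for every $M\in S$. Linkage. A linkage of length $l\geqslant 0$ connecting positions $(i_0,j_0)$ and $(i_l,j_l)$ of a matrix $M$ is a sequence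 $(i_0,j_0),\dots,(i_l,j_l)$ of positions of $M$ such that for each $t\in\{0,\dots,l-1\}$: if $t\equiv 0\pmod 4$, then $i_t=i_0$, $i_{t+1}=i_l$ and $j_t=j_{t+1}$; if $t\equiv 1\pmod 4$, then $i_t=i_{t+1}=i_l$ and the entries of $M$ at $(i_t,j_t)$ and $(i_{t+1},j_{t+1})$ are equal; if $t\equiv 2\pmod 4$, then $i_t=i_l$, $i_{t+1}=i_0$ and $j_t=j_{t+1}$; if $t\equiv 3\pmod 4$, then $i_t=i_{t+1}=i_0$ and the entries of $M$ at $(i_t,j_t)$ and $(i_{t+1},j_{t+1})$ are equal. *)

theory Defs
  imports "Jordan_Normal_Form.Matrix"
begin

section \<open>Matrices and their interpretations\<close>

text \<open>Indices are 0-based. The guards \<open>0 < n\<close> and \<open>0 < k\<close> are not redundant: a matrix without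
  columns satisfies the bound on the entries for \<open>k = 0\<close> as well. The number \<open>k\<close> is not part of a
  matrix, so that one matrix lies in \<open>matr n m k\<close> for all sufficiently large \<open>k\<close>.\<close>

definition matr :: "nat \<Rightarrow> nat \<Rightarrow> nat \<Rightarrow> nat mat set" where
  "matr n m k = {M \<in> carrier_mat n m. 0 < n \<and> 0 < k \<and> (\<forall>i<n. \<forall>j<m. M $$ (i, j) < k)}"

definition matrix_set :: "nat mat set \<Rightarrow> bool" where
  "matrix_set S \<longleftrightarrow> S \<subseteq> (\<Union>n. \<Union>m. \<Union>k. matr n m k)"

definition empty_matrix :: "nat mat \<Rightarrow> bool" where
  "empty_matrix M \<longleftrightarrow> dim_col M = 0"

definition rowwise_interpretation ::
    "nat \<Rightarrow> nat mat \<Rightarrow> (nat \<Rightarrow> 'a set) \<Rightarrow> (nat \<Rightarrow> nat \<Rightarrow> 'a) \<Rightarrow> bool" where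
  "rowwise_interpretation k M T f \<longleftrightarrow> (\<forall>i<dim_row M. f i \<in> {..<k} \<rightarrow> T i)"

definition left_columns :: "nat mat \<Rightarrow> (nat \<Rightarrow> nat \<Rightarrow> 'a) \<Rightarrow> 'a vec set" where
  "left_columns M f = set (cols (mat (dim_row M) (dim_col M) (\<lambda>(i, j). f i (M $$ (i, j)))))"

definition right_column :: "nat mat \<Rightarrow> (nat \<Rightarrow> nat \<Rightarrow> 'a) \<Rightarrow> 'a vec" where
  "right_column M f = vec (dim_row M) (\<lambda>i. f i 0)"


section \<open>Finitely complete categories\<close>

text \<open>\<open>Comp C g f\<close> is the composite ``\<open>g\<close> after \<open>f\<close>''; its value is irrelevant when \<open>g\<close> and \<open>f\<close>
  are not composable.\<close>

record ('o, 'm) category_data =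
  Obj :: "'o set"
  Arr :: "'m set"
  Dom :: "'m \<Rightarrow> 'o"
  Cod :: "'m \<Rightarrow> 'o"
  Id :: "'o \<Rightarrow> 'm"
  Comp :: "'m \<Rightarrow> 'm \<Rightarrow> 'm"

definition hom_set :: "('o, 'm) category_data \<Rightarrow> 'o \<Rightarrow> 'o \<Rightarrow> 'm set" where
  "hom_set C a b = {f \<in> Arr C. Dom C f = a \<and> Cod C f = b}"

definition is_category :: "('o, 'm) category_data \<Rightarrow> bool" where
  "is_category C \<longleftrightarrow>
     (\<forall>f\<in>Arr C. Dom C f \<in> Obj C \<and> Cod C f \<in> Obj C) \<and>
     (\<forall>a\<in>Obj C. Id C a \<in> hom_set C a a) \<and>
     (\<forall>a b c f g. f \<in> hom_set C a b \<longrightarrow> g \<in> hom_set C b c \<longrightarrow> Comp C g f \<in> hom_set C a c) \<and>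
     (\<forall>a b f. f \<in> hom_set C a b \<longrightarrow> Comp C f (Id C a) = f \<and> Comp C (Id C b) f = f) \<and>
     (\<forall>a b c d f g h. f \<in> hom_set C a b \<longrightarrow> g \<in> hom_set C b c \<longrightarrow> h \<in> hom_set C c d \<longrightarrow>
        Comp C h (Comp C g f) = Comp C (Comp C h g) f)"

definition is_functor ::
    "('p, 'q) category_data \<Rightarrow> ('o, 'm) category_data \<Rightarrow> ('p \<Rightarrow> 'o) \<Rightarrow> ('q \<Rightarrow> 'm) \<Rightarrow> bool" where
  "is_functor J C F F' \<longleftrightarrow>
     (\<forall>i\<in>Obj J. F i \<in> Obj C) \<and>
     (\<forall>i j u. u \<in> hom_set J i j \<longrightarrow> F' u \<in> hom_set C (F i) (F j)) \<and>
     (\<forall>i\<in>Obj J. F' (Id J i) = Id C (F i)) \<and>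
     (\<forall>i j l u v. u \<in> hom_set J i j \<longrightarrow> v \<in> hom_set J j l \<longrightarrow>
        F' (Comp J v u) = Comp C (F' v) (F' u))"

definition is_cone ::
    "('p, 'q) category_data \<Rightarrow> ('o, 'm) category_data \<Rightarrow> ('p \<Rightarrow> 'o) \<Rightarrow> ('q \<Rightarrow> 'm)
      \<Rightarrow> 'o \<Rightarrow> ('p \<Rightarrow> 'm) \<Rightarrow> bool" where
  "is_cone J C F F' L p \<longleftrightarrow>
     L \<in> Obj C \<and>
     (\<forall>i\<in>Obj J. p i \<in> hom_set C L (F i)) \<and>
     (\<forall>i j u. u \<in> hom_set J i j \<longrightarrow> Comp C (F' u) (p i) = p j)"

definition is_limit ::
    "('p, 'q) category_data \<Rightarrow> ('o, 'm) category_data \<Rightarrow> ('p \<Rightarrow> 'o) \<Rightarrow> ('q \<Rightarrow> 'm)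
      \<Rightarrow> 'o \<Rightarrow> ('p \<Rightarrow> 'm) \<Rightarrow> bool" where
  "is_limit J C F F' L p \<longleftrightarrow>
     is_cone J C F F' L p \<and>
     (\<forall>X q. is_cone J C F F' X q \<longrightarrow>
        (\<exists>!h. h \<in> hom_set C X L \<and> (\<forall>i\<in>Obj J. Comp C (p i) h = q i)))"

text \<open>Up to isomorphism, every finite category has natural numbers as objects and morphisms.
  Finiteness of \<open>Arr J\<close> implies that of \<open>Obj J\<close>.\<close>

definition finitely_complete :: "('o, 'm) category_data \<Rightarrow> bool" where
  "finitely_complete C \<longleftrightarrow>
     (\<forall>(J :: (nat, nat) category_data) F F'.
        is_category J \<longrightarrow> finite (Arr J) \<longrightarrow> is_functor J C F F' \<longrightarrow>
        (\<exists>L p. is_limit J C F F' L p))"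


section \<open>Closedness of internal relations\<close>

definition internal_relation ::
    "('o, 'm) category_data \<Rightarrow> nat \<Rightarrow> 'o \<Rightarrow> 'o \<Rightarrow> (nat \<Rightarrow> 'm) \<Rightarrow> bool" where
  "internal_relation C n A R r \<longleftrightarrow>
     R \<in> Obj C \<and> A \<in> Obj C \<and>
     (\<forall>i<n. r i \<in> hom_set C R A) \<and>
     (\<forall>X u v. u \<in> hom_set C X R \<longrightarrow> v \<in> hom_set C X R \<longrightarrow>
        (\<forall>i<n. Comp C (r i) u = Comp C (r i) v) \<longrightarrow> u = v)"

definition belongs_over ::
    "('o, 'm) category_data \<Rightarrow> nat \<Rightarrow> 'o \<Rightarrow> (nat \<Rightarrow> 'm) \<Rightarrow> 'o \<Rightarrow> 'm vec \<Rightarrow> bool" where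
  "belongs_over C n R r X g \<longleftrightarrow> (\<exists>u\<in>hom_set C X R. \<forall>i<n. Comp C (r i) u = g $ i)"

definition matrix_closed ::
    "('o, 'm) category_data \<Rightarrow> nat mat \<Rightarrow> 'o \<Rightarrow> 'o \<Rightarrow> (nat \<Rightarrow> 'm) \<Rightarrow> bool" where
  "matrix_closed C M A R r \<longleftrightarrow>
     (\<forall>n m k X f.
        M \<in> matr n m k \<longrightarrow> X \<in> Obj C \<longrightarrow>
        rowwise_interpretation k M (\<lambda>_. hom_set C X A) (\<lambda>_. f) \<longrightarrow>
        (\<forall>g\<in>left_columns M (\<lambda>_. f). belongs_over C n R r X g) \<longrightarrow>
        belongs_over C n R r X (right_column M (\<lambda>_. f)))"

definition has_closed_relations :: "('o, 'm) category_data \<Rightarrow> nat mat \<Rightarrow> bool" where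
  "has_closed_relations C M \<longleftrightarrow>
     (\<forall>A R r. internal_relation C (dim_row M) A R r \<longrightarrow> matrix_closed C M A R r)"

text \<open>Categories of all sizes are covered by the type variables of \<open>mclex\<close>. A non-inclusion
  \<open>\<not> mclex S \<subseteq> mclex U\<close> at given types is sensitive to their size: with finitely many morphisms, a finitely
  complete category is a preorder, which may leave no room for a counterexample.
  Any infinite types do, since membership in \<open>mclex S\<close> is a first-order property, so that a category
  separating \<open>mclex S\<close> from \<open>mclex U\<close> has a countable elementary subcategory that does the same.\<close>

definition mclex :: "nat mat set \<Rightarrow> ('o, 'm) category_data set" where
  "mclex S = {C. is_category C \<and> finitely_complete C \<and> (\<forall>M\<in>S. has_closed_relations C M)}"


section \<open>Linkages\<close>

text \<open>The positions of the linkage are \<open>(i 0, j 0), \<dots>, (i l, j l)\<close>.\<close>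

definition is_linkage :: "nat mat \<Rightarrow> nat \<Rightarrow> (nat \<Rightarrow> nat) \<Rightarrow> (nat \<Rightarrow> nat) \<Rightarrow> bool" where
  "is_linkage M l i j \<longleftrightarrow>
     (\<forall>t\<le>l. i t < dim_row M \<and> j t < dim_col M) \<and>
     (\<forall>t<l.
        (t mod 4 = 0 \<longrightarrow> i t = i 0 \<and> i (t + 1) = i l \<and> j t = j (t + 1)) \<and>
        (t mod 4 = 1 \<longrightarrow> i t = i (t + 1) \<and> i (t + 1) = i l \<and>
           M $$ (i t, j t) = M $$ (i (t + 1), j (t + 1))) \<and>
        (t mod 4 = 2 \<longrightarrow> i t = i l \<and> i (t + 1) = i 0 \<and> j t = j (t + 1)) \<and>
        (t mod 4 = 3 \<longrightarrow> i t = i (t + 1) \<and> i (t + 1) = i 0 \<and>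
           M $$ (i t, j t) = M $$ (i (t + 1), j (t + 1))))"

definition linked :: "nat mat \<Rightarrow> nat \<times> nat \<Rightarrow> nat \<times> nat \<Rightarrow> bool" where
  "linked M p q \<longleftrightarrow> (\<exists>l i j. is_linkage M l i j \<and> (i 0, j 0) = p \<and> (i l, j l) = q)"


section \<open>The procedure\<close>

definition row_without_zero :: "nat mat \<Rightarrow> bool" where
  "row_without_zero M \<longleftrightarrow> (\<exists>i<dim_row M. \<forall>j<dim_col M. M $$ (i, j) \<noteq> 0)"

definition row_pairs :: "nat mat set \<Rightarrow> (nat mat \<times> nat \<times> nat) set" where
  "row_pairs S = {(M, i, i'). M \<in> S \<and> i < dim_row M \<and> i' < dim_row M \<and> i \<noteq> i'}"

definition linkage_test :: "nat mat \<Rightarrow> nat \<Rightarrow> nat \<Rightarrow> nat \<Rightarrow> bool" where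
  "linkage_test M i j i' \<longleftrightarrow> (\<exists>j'<dim_col M. M $$ (i', j') = 0 \<and> linked M (i, j) (i', j'))"

text \<open>\<open>expansion_column S k N b\<close>: the column \<open>b\<close> may be adjoined to the current \<open>N\<close>, where entries
  range over \<open>{..<k}\<close>.\<close>

definition expansion_column :: "nat mat set \<Rightarrow> nat \<Rightarrow> nat mat \<Rightarrow> nat vec \<Rightarrow> bool" where
  "expansion_column S k N b \<longleftrightarrow>
     (\<exists>n' m' k' M M' f.
        M \<in> S \<inter> matr n' m' k' \<and>
        M' \<in> matr (dim_row N) m' k' \<and>
        set (rows M') \<subseteq> set (rows M) \<and>
        rowwise_interpretation k' M' (\<lambda>_. {..<k}) f \<and>
        left_columns M' f \<subseteq> set (cols N) \<and>
        b = right_column M' f \<and>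
        b \<notin> set (cols N))"

definition adjoin_column :: "nat mat \<Rightarrow> nat vec \<Rightarrow> nat mat" where
  "adjoin_column N b = mat_of_cols (dim_row N) (cols N @ [b])"

text \<open>The procedure is nondeterministic: the order in which pairs of rows, matrices in \<open>U\<close> and
  expansions are processed, the chosen entry \<open>0\<close> in Step 1 and the number \<open>k\<close> with
  \<open>N \<in> matr n m k\<close> in Step 2 are arbitrary. The arguments of \<open>Step1\<close> and \<open>Step2\<close> hold what is still
  to be processed; \<open>Expanding V k N\<close> is the phase of Step 2 with current expanded matrix \<open>N\<close> and
  matrices \<open>V\<close> still to be processed. \<open>Decision True\<close> is the positive decision.\<close>

datatype state =
    Step0
  | Step1
  | Step1_Pairs "(nat mat \<times> nat \<times> nat) set"
  | Step2 "nat mat set"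
  | Expanding "nat mat set" nat "nat mat"
  | Step3
  | Decision bool

inductive step :: "nat mat set \<Rightarrow> nat mat set \<Rightarrow> state \<Rightarrow> state \<Rightarrow> bool"
  for S U :: "nat mat set" where
  step0_positive:
    "\<exists>M\<in>S. empty_matrix M \<Longrightarrow> step S U Step0 (Decision True)"
| step0_negative:
    "\<not> (\<exists>M\<in>S. empty_matrix M) \<Longrightarrow> \<exists>N\<in>U. empty_matrix N \<Longrightarrow> step S U Step0 (Decision False)"
| step0_continue:
    "\<not> (\<exists>M\<in>S. empty_matrix M) \<Longrightarrow> \<not> (\<exists>N\<in>U. empty_matrix N) \<Longrightarrow> step S U Step0 Step1"
| step1_positive:
    "\<exists>M\<in>S. row_without_zero M \<Longrightarrow> step S U Step1 (Decision True)"
| step1_continue: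
    "\<not> (\<exists>M\<in>S. row_without_zero M) \<Longrightarrow> step S U Step1 (Step1_Pairs (row_pairs S))"
| pair_positive:
    "(M, i, i') \<in> P \<Longrightarrow> j < dim_col M \<Longrightarrow> M $$ (i, j) = 0 \<Longrightarrow> \<not> linkage_test M i j i' \<Longrightarrow>
     step S U (Step1_Pairs P) (Decision True)"
| pair_continue:
    "(M, i, i') \<in> P \<Longrightarrow> j < dim_col M \<Longrightarrow> M $$ (i, j) = 0 \<Longrightarrow> linkage_test M i j i' \<Longrightarrow>
     step S U (Step1_Pairs P) (Step1_Pairs (P - {(M, i, i')}))"
| pairs_done:
    "step S U (Step1_Pairs {}) (Step2 U)"
| step2_select:
    "N \<in> V \<Longrightarrow> N \<in> matr n m k \<Longrightarrow> step S U (Step2 V) (Expanding (V - {N}) k N)"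
| expand:
    "expansion_column S k N b \<Longrightarrow>
     step S U (Expanding V k N) (Expanding V k (adjoin_column N b))"
| expanded_negative:
    "\<not> (\<exists>b. expansion_column S k N b) \<Longrightarrow> 0\<^sub>v (dim_row N) \<notin> set (cols N) \<Longrightarrow>
     step S U (Expanding V k N) (Decision False)"
| expanded_continue:
    "\<not> (\<exists>b. expansion_column S k N b) \<Longrightarrow> 0\<^sub>v (dim_row N) \<in> set (cols N) \<Longrightarrow>
     step S U (Expanding V k N) (Step2 V)"
| step2_done:
    "step S U (Step2 {}) Step3"
| step3:
    "step S U Step3 (Decision True)"

definition reachable :: "nat mat set \<Rightarrow> nat mat set \<Rightarrow> state \<Rightarrow> bool" where
  "reachable S U = rtranclp (step S U) Step0"

text \<open>Every run of the procedure is finite, and a run can only stop with a decision.\<close>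

definition procedure_terminates :: "nat mat set \<Rightarrow> nat mat set \<Rightarrow> bool" where
  "procedure_terminates S U \<longleftrightarrow>
     \<not> (\<exists>s. s 0 = Step0 \<and> (\<forall>t. step S U (s t) (s (Suc t)))) \<and>
     (\<forall>s. reachable S U s \<longrightarrow> (\<nexists>s'. step S U s s') \<longrightarrow> (\<exists>d. s = Decision d))"

end

(* If the columns of a matrix satisfy phi (M (i, j)) = psi (M (i', j)) for all j but phi 0 and psi 0 differ,
   then applying closedness to a diagonal relation makes any two parallel arrows equal; such phi and
   psi exist exactly when Step 1 stops. In general, closedness under M implies closedness under
   row-wise interpretations of matrices built from rows of M, so that every column adjoined in Step 2
   belongs to any relation to which the original columns belong.

   Conversely, if the expanded N lacks the zero column, its columns form an n-ary relation Q on
   {0, ..., k-1} that is closed in this row-wise sense. The opposite of the category of finite sets with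
   a row-wise closed n-ary relation is finitely complete; jointly monic families in it are
   jointly surjective families of maps, and Step 1 guarantees that the maps witnessing
   closedness are well defined. In it, the structure on n points with one tuple is a relation on the
   one-point structure, and evaluating it at ({0, ..., k-1}, Q) shows that it is not N-closed. *)

theory Submission
  imports Defs "HOL-Library.Countable"
begin

section \<open>Finite limits\<close>

text \<open>Step 1 is a connectivity question. Regard the values of two rows as the two sides of a
  bipartite graph whose edges are the columns. A linkage is a walk in this graph, and Boolean
  functions \<phi>, \<psi> that agree along all columns are unions of components. They can differ at
  0 exactly when the two zeros lie in different components, and a row without 0 is the case of an
  isolated zero. The position of the chosen 0 does not enter this criterion. The opposite category
  appears because points of a carrier should become arrows \<open>X \<rightarrow> A\<close> and
  tuples of \<open>Q\<close> arrows \<open>X \<rightarrow> R\<close>: the relation over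
  \<open>X\<close> is then literally \<open>Q\<close>. The arity of the structures is the number of
  rows of the rejected matrix, so the counterexample depends on that matrix. Empty matrices in
  \<open>U\<close> are refuted by the two-element chain instead. The free choices of the procedure
  are absorbed by a state invariant that speaks only of facts that do not depend on them, such as
  separability of rows and reachability of the zero column. Maximality of an expansion is used only
  for negative decisions.\<close>

lemma comp_in_hom:
  "is_category C \<Longrightarrow> f \<in> hom_set C a b \<Longrightarrow> g \<in> hom_set C b c \<Longrightarrow> Comp C g f \<in> hom_set C a c"
  unfolding is_category_def by blast

lemma comp_assoc:
  "is_category C \<Longrightarrow> f \<in> hom_set C a b \<Longrightarrow> g \<in> hom_set C b c \<Longrightarrow> h \<in> hom_set C c d \<Longrightarrow>
    Comp C h (Comp C g f) = Comp C (Comp C h g) f"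
  unfolding is_category_def by blast

lemma id_in_hom: "is_category C \<Longrightarrow> a \<in> Obj C \<Longrightarrow> Id C a \<in> hom_set C a a"
  unfolding is_category_def by blast

lemma comp_id:
  assumes "is_category C" and "f \<in> hom_set C a b"
  shows "Comp C f (Id C a) = f" and "Comp C (Id C b) f = f"
  using assms unfolding is_category_def by blast+

lemma hom_objs:
  assumes "is_category C" and "f \<in> hom_set C a b"
  shows "a \<in> Obj C" and "b \<in> Obj C"
  using assms unfolding is_category_def hom_set_def by blast+

text \<open>This is the only form in which finite completeness is used: with \<open>q = 0\<close> it
  gives powers, and with equations it gives the object of solutions. Equations between composites
  with arbitrary targets \<open>D t\<close> cover pullbacks and equalizers alike.\<close>

lemma limit_of_equations:
  fixes C :: "('o, 'm) category_data" and p q :: nat and a b :: "nat \<Rightarrow> nat"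
  assumes cat: "is_category C" and fc: "finitely_complete C"
    and B: "\<And>i. i < p \<Longrightarrow> B i \<in> Obj C"
    and ab: "\<And>t. t < q \<Longrightarrow> a t < p" "\<And>t. t < q \<Longrightarrow> b t < p"
    and u: "\<And>t. t < q \<Longrightarrow> u t \<in> hom_set C (B (a t)) (D t)"
    and v: "\<And>t. t < q \<Longrightarrow> v t \<in> hom_set C (B (b t)) (D t)"
  obtains L pr where "L \<in> Obj C" and "\<And>i. i < p \<Longrightarrow> pr i \<in> hom_set C L (B i)"
    and "\<And>t. t < q \<Longrightarrow> Comp C (u t) (pr (a t)) = Comp C (v t) (pr (b t))"
    and "\<And>X h. X \<in> Obj C \<Longrightarrow> (\<And>i. i < p \<Longrightarrow> h i \<in> hom_set C X (B i)) \<Longrightarrow>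
      (\<And>t. t < q \<Longrightarrow> Comp C (u t) (h (a t)) = Comp C (v t) (h (b t))) \<Longrightarrow>
      \<exists>w\<in>hom_set C X L. \<forall>i<p. Comp C (pr i) w = h i"
    and "\<And>X w w'. w \<in> hom_set C X L \<Longrightarrow> w' \<in> hom_set C X L \<Longrightarrow>
      (\<And>i. i < p \<Longrightarrow> Comp C (pr i) w = Comp C (pr i) w') \<Longrightarrow> w = w'"
proof -
  \<comment> \<open>The index category has objects \<open>{..<p + q}\<close> with identities of the same names; the arrows
    \<open>p + q + 2 * t\<close> and \<open>p + q + 2 * t + 1\<close> go to the object \<open>p + t\<close> and are sent to \<open>u t\<close>
    and \<open>v t\<close>.\<close>
  define N where "N = p + q"
  define dm where "dm x = (if x < N then x else
      if even (x - N) then a ((x - N) div 2) else b ((x - N) div 2))" for x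
  define cd where "cd x = (if x < N then x else p + (x - N) div 2)" for x
  define J :: "(nat, nat) category_data" where
    "J = \<lparr>Obj = {..<N}, Arr = {..<N + 2 * q}, Dom = dm, Cod = cd, Id = (\<lambda>x. x),
       Comp = (\<lambda>g f. if g < N then f else g)\<rparr>"
  define F where "F x = (if x < p then B x else D (x - p))" for x
  define F' where "F' x = (if x < N then Id C (F x) else
      if even (x - N) then u ((x - N) div 2) else v ((x - N) div 2))" for x
  have half: "(x - N) div 2 < q" if "x < N + 2 * q" "\<not> x < N" for x
    using that by linarith
  have dm_p: "dm x < p" if "x < N + 2 * q" "\<not> x < N" for x
    using half[OF that] ab that by (auto simp: dm_def)
  have cd_p: "p \<le> cd x \<and> cd x < N" if "x < N + 2 * q" "\<not> x < N" for x
    using half[OF that] that by (auto simp: cd_def N_def)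
  have [simp]: "Obj J = {..<N}" "Arr J = {..<N + 2 * q}" "Dom J = dm" "Cod J = cd"
    "Id J = (\<lambda>x. x)" "Comp J = (\<lambda>g f. if g < N then f else g)"
    by (simp_all add: J_def)
  have homJ: "x \<in> hom_set J i j \<longleftrightarrow> x < N + 2 * q \<and> dm x = i \<and> cd x = j" for x i j
    by (simp add: hom_set_def)
  have lowN: "dm x = x" "cd x = x" if "x < N" for x
    using that by (simp_all add: dm_def cd_def)
  \<comment> \<open>Non-identity arrows start below \<open>p\<close> and end at or above
    \<open>p\<close>, so two of them are never composable. Hence one factor of every composite is an
    identity and the composite is the other factor.\<close>
  have comp_low: "f < N \<or> g < N" if "f < N + 2 * q" "g < N + 2 * q" "cd f = dm g" for f g
    using cd_p[OF that(1)] dm_p[OF that(2)] that(3) by (cases "f < N"; cases "g < N") auto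
  have catJ: "is_category J"
    unfolding is_category_def homJ
  proof (intro conjI ballI allI impI)
    fix f assume "f \<in> Arr J"
    then have f: "f < N + 2 * q" by simp
    have "dm f < N" "cd f < N"
      using dm_p[OF f] cd_p[OF f] lowN by (cases "f < N"; simp add: N_def; fail)+
    then show "Dom J f \<in> Obj J" "Cod J f \<in> Obj J" by simp_all
  next
    fix i j l f g
    assume "f < N + 2 * q \<and> dm f = i \<and> cd f = j" and "g < N + 2 * q \<and> dm g = j \<and> cd g = l"
    then show "Comp J g f < N + 2 * q" "dm (Comp J g f) = i" "cd (Comp J g f) = l"
      using comp_low[of f g] lowN by auto
  next
    fix i j f assume f: "f < N + 2 * q \<and> dm f = i \<and> cd f = j"
    then have "i < N" "j < N"
      using dm_p[of f] cd_p[of f] lowN by (cases "f < N"; auto simp: N_def)+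
    then show "Comp J f (Id J i) = f" "Comp J (Id J j) f = f"
      using f lowN by auto
  qed (use lowN in auto)
  have F_obj: "F x \<in> Obj C" if "x < N" for x
    using that B hom_objs(2)[OF cat u[of "x - p"]] by (auto simp: F_def N_def)
  have F'_hom: "F' x \<in> hom_set C (F (dm x)) (F (cd x))" if "x < N + 2 * q" for x
  proof (cases "x < N")
    case True
    then show ?thesis using lowN id_in_hom[OF cat F_obj] by (simp add: F'_def)
  next
    case False
    then show ?thesis
      using half[OF that False] u v ab by (simp add: F'_def dm_def cd_def F_def)
  qed
  have func: "is_functor J C F F'"
    unfolding is_functor_def homJ
  proof (intro conjI ballI allI impI)
    fix i j l x y
    assume x: "x < N + 2 * q \<and> dm x = i \<and> cd x = j" and y: "y < N + 2 * q \<and> dm y = j \<and> cd y = l"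
    consider "y < N" | "x < N" "\<not> y < N" using comp_low[of x y] x y by auto
    then show "F' (Comp J y x) = Comp C (F' y) (F' x)"
    proof cases
      case 1
      have "y = cd x" using 1 lowN(1)[of y] x y by simp
      then have "F' y = Id C (F (cd x))" using 1 by (simp add: F'_def)
      then show ?thesis using 1 comp_id(2)[OF cat F'_hom[of x]] x by simp
    next
      case 2
      have "x = dm y" using 2 lowN(2)[of x] x y by simp
      then have "F' x = Id C (F (dm y))" using 2 by (simp add: F'_def)
      then show ?thesis using 2 comp_id(1)[OF cat F'_hom[of y]] y by simp
    qed
  next
    fix i assume "i \<in> Obj J" then show "F i \<in> Obj C" using F_obj by simp
  next
    fix i j x assume "x < N + 2 * q \<and> dm x = i \<and> cd x = j"
    then show "F' x \<in> hom_set C (F i) (F j)" using F'_hom by blast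
  next
    fix i assume "i \<in> Obj J" then show "F' (Id J i) = Id C (F i)" by (simp add: F'_def)
  qed
  obtain L pr where lim: "is_limit J C F F' L pr"
    using fc catJ func unfolding finitely_complete_def by fastforce
  then have cone: "is_cone J C F F' L pr" unfolding is_limit_def by blast
  have L: "L \<in> Obj C" using cone by (simp add: is_cone_def)
  have prF: "pr i \<in> hom_set C L (F i)" if "i < N" for i
    using cone that by (simp add: is_cone_def)
  have pr: "pr i \<in> hom_set C L (B i)" if "i < p" for i
    using prF[of i] that by (simp add: F_def N_def)
  have cone_arr: "Comp C (F' x) (pr (dm x)) = pr (cd x)" if "x < N + 2 * q" for x
    using cone that unfolding is_cone_def homJ by blast
  have arr_u: "F' (N + 2 * t) = u t \<and> dm (N + 2 * t) = a t \<and> cd (N + 2 * t) = p + t"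
    and arr_v: "F' (N + 2 * t + 1) = v t \<and> dm (N + 2 * t + 1) = b t \<and> cd (N + 2 * t + 1) = p + t" for t
    by (simp_all add: F'_def dm_def cd_def)
  have eqs: "Comp C (u t) (pr (a t)) = Comp C (v t) (pr (b t))"
    and pr_high: "pr (p + t) = Comp C (u t) (pr (a t))" if "t < q" for t
    using cone_arr[of "N + 2 * t"] cone_arr[of "N + 2 * t + 1"] arr_u[of t] arr_v[of t] that by auto
  \<comment> \<open>A cone is determined by its legs at the first \<open>p\<close> objects: the leg
    at \<open>p + t\<close> is forced by the arrow \<open>u t\<close>, and compatibility with
    \<open>v t\<close> is then the equation numbered \<open>t\<close>.\<close>
  define ext where "ext h x = (if x < p then h x else Comp C (u (x - p)) (h (a (x - p))))" for h :: "nat \<Rightarrow> 'm" and x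
  have ext_cone: "is_cone J C F F' X (ext h)"
    if X: "X \<in> Obj C" and h: "\<And>i. i < p \<Longrightarrow> h i \<in> hom_set C X (B i)"
      and e: "\<And>t. t < q \<Longrightarrow> Comp C (u t) (h (a t)) = Comp C (v t) (h (b t))" for X h
  proof -
    have hom: "ext h x \<in> hom_set C X (F x)" if "x < N" for x
    proof (cases "x < p")
      case False
      then have t: "x - p < q" using that by (simp add: N_def)
      show ?thesis
        using False comp_in_hom[OF cat h[OF ab(1)[OF t]] u[OF t]] by (simp add: ext_def F_def)
    qed (use h in \<open>simp add: ext_def F_def\<close>)
    have "Comp C (F' x) (ext h (dm x)) = ext h (cd x)" if x: "x < N + 2 * q" for x
    proof (cases "x < N")
      case True
      then show ?thesis using comp_id(2)[OF cat hom] lowN by (simp add: F'_def)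
    next
      case False
      have t: "(x - N) div 2 < q" using half[OF x False] .
      then show ?thesis
        using False e[OF t] ab[OF t] by (simp add: ext_def F'_def dm_def cd_def)
    qed
    then show ?thesis unfolding is_cone_def homJ using X hom by auto
  qed
  have ex: "\<exists>!w. w \<in> hom_set C X L \<and> (\<forall>i\<in>Obj J. Comp C (pr i) w = r i)"
    if "is_cone J C F F' X r" for X r
    using lim that unfolding is_limit_def by blast
  show thesis
  proof (rule that[OF L pr eqs])
    fix X h
    assume "X \<in> Obj C" "\<And>i. i < p \<Longrightarrow> h i \<in> hom_set C X (B i)"
      "\<And>t. t < q \<Longrightarrow> Comp C (u t) (h (a t)) = Comp C (v t) (h (b t))"
    then obtain w where w: "w \<in> hom_set C X L" "\<forall>i\<in>Obj J. Comp C (pr i) w = ext h i"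
      using ex[OF ext_cone[of X h]] by blast
    have "Comp C (pr i) w = h i" if "i < p" for i
      using w(2) that by (simp add: ext_def N_def)
    then show "\<exists>w\<in>hom_set C X L. \<forall>i<p. Comp C (pr i) w = h i" using w(1) by blast
  next
    fix X w w'
    assume w: "w \<in> hom_set C X L" "w' \<in> hom_set C X L"
      and eq: "\<And>i. i < p \<Longrightarrow> Comp C (pr i) w = Comp C (pr i) w'"
    let ?h = "\<lambda>i. Comp C (pr i) w"
    have X: "X \<in> Obj C" using hom_objs(1)[OF cat w(1)] .
    have c: "is_cone J C F F' X (ext ?h)"
    proof (rule ext_cone[OF X])
      fix i assume "i < p" then show "?h i \<in> hom_set C X (B i)" using comp_in_hom[OF cat w(1) pr] by blast
    next
      fix t assume t: "t < q"
      show "Comp C (u t) (?h (a t)) = Comp C (v t) (?h (b t))"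
        using comp_assoc[OF cat w(1) pr[OF ab(1)[OF t]] u[OF t]]
          comp_assoc[OF cat w(1) pr[OF ab(2)[OF t]] v[OF t]] eqs[OF t] by simp
    qed
    have key: "Comp C (pr i) z = ext ?h i" if z: "z \<in> hom_set C X L"
      "\<And>i. i < p \<Longrightarrow> Comp C (pr i) w = Comp C (pr i) z" and i: "i < N" for z i
    proof (cases "i < p")
      case True
      then show ?thesis using z(2) by (simp add: ext_def)
    next
      case False
      then have t: "i - p < q" "i = p + (i - p)" using i by (auto simp: N_def)
      have "Comp C (pr i) z = Comp C (Comp C (u (i - p)) (pr (a (i - p)))) z"
        using pr_high[OF t(1)] t(2) by simp
      also have "\<dots> = Comp C (u (i - p)) (Comp C (pr (a (i - p))) z)"
        using comp_assoc[OF cat z(1) pr[OF ab(1)[OF t(1)]] u[OF t(1)]] by simp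
      finally show ?thesis using False z(2)[OF ab(1)[OF t(1)]] by (simp add: ext_def)
    qed
    have "\<forall>i\<in>Obj J. Comp C (pr i) w = ext ?h i" "\<forall>i\<in>Obj J. Comp C (pr i) w' = ext ?h i"
      using key[OF w(1) refl] key[OF w(2) eq] by simp_all
    then show "w = w'" using ex[OF c] w by blast
  qed
qed

section \<open>Closedness under row-wise interpretations\<close>

lemma left_columns_eq:
  "left_columns M f = (\<lambda>j. vec (dim_row M) (\<lambda>i. f i (M $$ (i, j)))) ` {..<dim_col M}"
  unfolding left_columns_def cols_def set_map
  by (rule image_cong) auto

lemma internal_relationD:
  assumes "internal_relation C n A R r"
  shows "R \<in> Obj C" and "A \<in> Obj C" and "\<And>i. i < n \<Longrightarrow> r i \<in> hom_set C R A"
    and "\<And>X u v. u \<in> hom_set C X R \<Longrightarrow> v \<in> hom_set C X R \<Longrightarrow>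
      (\<And>i. i < n \<Longrightarrow> Comp C (r i) u = Comp C (r i) v) \<Longrightarrow> u = v"
  using assms unfolding internal_relation_def by blast+

lemma has_closed_relationsD:
  assumes "has_closed_relations C N" and N: "N \<in> matr n m k" and "internal_relation C n A R r"
    and X: "X \<in> Obj C" and f: "\<And>v. v < k \<Longrightarrow> f v \<in> hom_set C X A"
    and left: "\<And>j. j < m \<Longrightarrow> \<exists>u\<in>hom_set C X R. \<forall>i<n. Comp C (r i) u = f (N $$ (i, j))"
  shows "\<exists>u\<in>hom_set C X R. \<forall>i<n. Comp C (r i) u = f 0"
proof -
  have dims: "dim_row N = n" "dim_col N = m" using N by (auto simp: matr_def)
  have "\<forall>g\<in>left_columns N (\<lambda>_. f). belongs_over C n R r X g"
    using left by (auto simp: left_columns_eq dims belongs_over_def)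
  moreover have "rowwise_interpretation k N (\<lambda>_. hom_set C X A) (\<lambda>_. f)"
    using f by (simp add: rowwise_interpretation_def)
  moreover have "matrix_closed C N A R r"
    using assms(1,3) dims unfolding has_closed_relations_def by blast
  ultimately have "belongs_over C n R r X (right_column N (\<lambda>_. f))"
    using N X unfolding matrix_closed_def by blast
  then show ?thesis by (auto simp: belongs_over_def right_column_def dims)
qed

text \<open>Closedness is applied to the \<open>dim_row M\<close>-ary relation on \<open>A\<^sup>n\<close> of all \<open>x\<close> such that the tuple
  of the \<open>i\<close>-th components of the \<open>x (\<sigma> i)\<close> belongs to \<open>R\<close>.\<close>

lemma rowwise_closed:
  assumes cat: "is_category C" and fc: "finitely_complete C" and cl: "has_closed_relations C M"
    and M: "M \<in> matr n' m' k'" and R: "internal_relation C n A R r" and X: "X \<in> Obj C"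
    and \<sigma>: "\<And>i. i < n \<Longrightarrow> \<sigma> i < n'"
    and g: "\<And>i v. i < n \<Longrightarrow> v < k' \<Longrightarrow> g i v \<in> hom_set C X A"
    and left: "\<And>j. j < m' \<Longrightarrow> \<exists>u\<in>hom_set C X R. \<forall>i<n. Comp C (r i) u = g i (M $$ (\<sigma> i, j))"
  shows "\<exists>u\<in>hom_set C X R. \<forall>i<n. Comp C (r i) u = g i 0"
proof -
  have dims: "dim_row M = n'" "dim_col M = m'" and k': "0 < k'"
    and entry: "\<And>i j. i < n' \<Longrightarrow> j < m' \<Longrightarrow> M $$ (i, j) < k'"
    using M by (auto simp: matr_def)
  note A = internal_relationD(2)[OF R] and r = internal_relationD(3)[OF R]
  \<comment> \<open>With no equations the limit is the power of \<open>A\<close> with exponent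
    \<open>n\<close>.\<close>
  obtain P \<pi> where P: "P \<in> Obj C" and \<pi>: "\<And>i. i < n \<Longrightarrow> \<pi> i \<in> hom_set C P A"
    and tuple: "\<And>X h. X \<in> Obj C \<Longrightarrow> (\<And>i. i < n \<Longrightarrow> h i \<in> hom_set C X A) \<Longrightarrow>
      \<exists>w\<in>hom_set C X P. \<forall>i<n. Comp C (\<pi> i) w = h i"
    by (rule limit_of_equations[OF cat fc, of n "\<lambda>_. A" 0]) (use A in auto)
  \<comment> \<open>The last index \<open>n'\<close> carries an element of \<open>R\<close>; the
    equations below make it the witness that the selected components form a tuple in the
    relation.\<close>
  define B where "B x = (if x < n' then P else R)" for x
  have B: "B i \<in> Obj C" if "i < Suc n'" for i using P internal_relationD(1)[OF R] by (simp add: B_def)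
  have \<sigma>': "\<sigma> t < Suc n'" and \<pi>': "\<pi> t \<in> hom_set C (B (\<sigma> t)) A"
    and r': "r t \<in> hom_set C (B n') A" if "t < n" for t
    using \<sigma>[OF that] \<pi>[OF that] r[OF that] by (auto simp: B_def)
  obtain L x where L: "L \<in> Obj C" and x: "\<And>i. i < Suc n' \<Longrightarrow> x i \<in> hom_set C L (B i)"
    and eq: "\<And>t. t < n \<Longrightarrow> Comp C (\<pi> t) (x (\<sigma> t)) = Comp C (r t) (x n')"
    and univ: "\<And>X h. X \<in> Obj C \<Longrightarrow> (\<And>i. i < Suc n' \<Longrightarrow> h i \<in> hom_set C X (B i)) \<Longrightarrow>
      (\<And>t. t < n \<Longrightarrow> Comp C (\<pi> t) (h (\<sigma> t)) = Comp C (r t) (h n')) \<Longrightarrow>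
      \<exists>w\<in>hom_set C X L. \<forall>i<Suc n'. Comp C (x i) w = h i"
    and mono: "\<And>X w w'. w \<in> hom_set C X L \<Longrightarrow> w' \<in> hom_set C X L \<Longrightarrow>
      (\<And>i. i < Suc n' \<Longrightarrow> Comp C (x i) w = Comp C (x i) w') \<Longrightarrow> w = w'"
  proof (rule limit_of_equations[OF cat fc, of "Suc n'" B n \<sigma> "\<lambda>_. n'" \<pi> "\<lambda>_. A" r], goal_cases)
    case (6 L pr)
    show ?case by (rule that) (fact 6)+
  qed (simp_all add: B \<sigma>' \<pi>' r')
  have y: "x n' \<in> hom_set C L R" using x[of n'] by (simp add: B_def)
  have xP: "x i \<in> hom_set C L P" if "i < n'" for i using x[of i] that by (simp add: B_def)
  have slide: "Comp C (r i) (Comp C (x n') w) = Comp C (\<pi> i) (Comp C (x (\<sigma> i)) w)"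
    if w: "w \<in> hom_set C Y L" and i: "i < n" for w Y i
    using comp_assoc[OF cat w y r[OF i]] comp_assoc[OF cat w xP[OF \<sigma>[OF i]] \<pi>[OF i]] eq[OF i] by simp
  \<comment> \<open>The witness \<open>x n'\<close> is not among the \<open>n'\<close> projections
    of this relation. Joint monicity survives its removal because it is determined by the other
    components through the jointly monic \<open>r\<close>.\<close>
  have rel: "internal_relation C n' P L x"
    unfolding internal_relation_def
  proof (intro conjI allI impI)
    fix Y u v
    assume uv: "u \<in> hom_set C Y L" "v \<in> hom_set C Y L"
      and e: "\<forall>i<n'. Comp C (x i) u = Comp C (x i) v"
    have "Comp C (x n') u = Comp C (x n') v"
      using internal_relationD(4)[OF R comp_in_hom[OF cat uv(1) y] comp_in_hom[OF cat uv(2) y]]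
        slide uv e \<sigma> by metis
    then show "u = v" using mono[OF uv] e less_Suc_eq by metis
  qed (use P L xP in auto)
  \<comment> \<open>Bundling the \<open>n\<close> values \<open>g i v\<close> into one arrow
    \<open>f v\<close> to the power turns a row-wise interpretation into an interpretation by a
    single function.\<close>
  have "\<exists>w\<in>hom_set C X P. \<forall>i<n. Comp C (\<pi> i) w = g i v" if "v < k'" for v
    by (rule tuple[OF X]) (rule g[OF _ that])
  then obtain f where f: "\<And>v. v < k' \<Longrightarrow> f v \<in> hom_set C X P"
    and \<pi>f: "\<And>v i. v < k' \<Longrightarrow> i < n \<Longrightarrow> Comp C (\<pi> i) (f v) = g i v"
    by metis
  have left': "\<exists>w\<in>hom_set C X L. \<forall>i<n'. Comp C (x i) w = f (M $$ (i, j))" if j: "j < m'" for j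
  proof -
    obtain u where u: "u \<in> hom_set C X R" "\<forall>i<n. Comp C (r i) u = g i (M $$ (\<sigma> i, j))"
      using left[OF j] by blast
    define h where "h i = (if i < n' then f (M $$ (i, j)) else u)" for i
    obtain w where w: "w \<in> hom_set C X L" "\<forall>i<Suc n'. Comp C (x i) w = h i"
    proof (rule bexE[OF univ[OF X, of h]])
      show "h i \<in> hom_set C X (B i)" for i
        using f entry[OF _ j] u(1) by (simp add: h_def B_def)
      show "Comp C (\<pi> t) (h (\<sigma> t)) = Comp C (r t) (h n')" if "t < n" for t
        using u(2) that \<pi>f[OF entry[OF \<sigma>[OF that] j] that] \<sigma>[OF that] by (simp add: h_def)
    qed blast
    have "\<forall>i<n'. Comp C (x i) w = f (M $$ (i, j))" using w(2) by (simp add: h_def)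
    then show ?thesis using w(1) by blast
  qed
  obtain w where w: "w \<in> hom_set C X L" "\<And>i. i < n' \<Longrightarrow> Comp C (x i) w = f 0"
    using has_closed_relationsD[OF cl M rel X f left'] by blast
  have "Comp C (r i) (Comp C (x n') w) = g i 0" if "i < n" for i
    using slide[OF w(1) that] w(2)[OF \<sigma>[OF that]] \<pi>f[OF k' that] by simp
  then show ?thesis using comp_in_hom[OF cat w(1) y] by blast
qed

lemma has_closed_relationsI:
  assumes "\<And>m k A R r X f. N \<in> matr (dim_row N) m k \<Longrightarrow> internal_relation C (dim_row N) A R r \<Longrightarrow>
    X \<in> Obj C \<Longrightarrow> (\<And>v. v < k \<Longrightarrow> f v \<in> hom_set C X A) \<Longrightarrow> 0 < k \<Longrightarrow> dim_col N = m \<Longrightarrow>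
    (\<And>i j. i < dim_row N \<Longrightarrow> j < m \<Longrightarrow> N $$ (i, j) < k) \<Longrightarrow>
    (\<And>j. j < m \<Longrightarrow> \<exists>u\<in>hom_set C X R. \<forall>i<dim_row N. Comp C (r i) u = f (N $$ (i, j))) \<Longrightarrow>
    \<exists>u\<in>hom_set C X R. \<forall>i<dim_row N. Comp C (r i) u = f 0"
  shows "has_closed_relations C N"
  unfolding has_closed_relations_def matrix_closed_def
proof (intro allI impI)
  fix A R r n m k X f
  assume R: "internal_relation C (dim_row N) A R r" and N: "N \<in> matr n m k" and X: "X \<in> Obj C"
    and f: "rowwise_interpretation k N (\<lambda>_. hom_set C X A) (\<lambda>_. f)"
    and left: "\<forall>g\<in>left_columns N (\<lambda>_. f). belongs_over C n R r X g"
  have d: "dim_row N = n" "dim_col N = m" "0 < n" "0 < k"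
    and entry: "\<And>i j. i < n \<Longrightarrow> j < m \<Longrightarrow> N $$ (i, j) < k"
    using N by (auto simp: matr_def)
  have f': "f v \<in> hom_set C X A" if "v < k" for v
    using f d that unfolding rowwise_interpretation_def by auto
  have "\<exists>u\<in>hom_set C X R. \<forall>i<n. Comp C (r i) u = f (N $$ (i, j))" if j: "j < m" for j
  proof -
    have "vec n (\<lambda>i. f (N $$ (i, j))) \<in> left_columns N (\<lambda>_. f)"
      using j d by (auto simp: left_columns_eq)
    then show ?thesis using left unfolding belongs_over_def by fastforce
  qed
  then have "\<exists>u\<in>hom_set C X R. \<forall>i<n. Comp C (r i) u = f 0"
    using assms[of m k A R r X f] N R X f' d entry by auto
  then show "belongs_over C n R r X (right_column N (\<lambda>_. f))"
    unfolding belongs_over_def right_column_def using d by auto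
qed

text \<open>Without columns the premise of \<open>rowwise_closed\<close> about left columns is
  vacuous, so the constant tuple at \<open>f 0\<close> belongs to every relation. Row 0 serves as
  the selected row throughout.\<close>

lemma empty_matrix_closed:
  assumes cat: "is_category C" and fc: "finitely_complete C" and cl: "has_closed_relations C M"
    and M: "M \<in> matr n m k" and e: "empty_matrix M"
  shows "has_closed_relations C N"
proof (rule has_closed_relationsI)
  fix m' k' A R r X f
  assume R: "internal_relation C (dim_row N) A R r" and X: "X \<in> Obj C"
    and f: "\<And>v. v < k' \<Longrightarrow> f v \<in> hom_set C X A" "0 < k'"
  show "\<exists>u\<in>hom_set C X R. \<forall>i<dim_row N. Comp C (r i) u = f 0"
    using rowwise_closed[OF cat fc cl M R X, of "\<lambda>_. 0" "\<lambda>_ _. f 0"] f M e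
    by (auto simp: matr_def empty_matrix_def)
qed

lemma separated_rows_thin:
  fixes \<phi> \<psi> :: "nat \<Rightarrow> bool"
  assumes cat: "is_category C" and fc: "finitely_complete C" and cl: "has_closed_relations C M"
    and M: "M \<in> matr n m k" and i: "i < n" "i' < n"
    and eq: "\<And>j. j < m \<Longrightarrow> \<phi> (M $$ (i, j)) = \<psi> (M $$ (i', j))" and neq: "\<phi> 0 \<noteq> \<psi> 0"
    and f: "f \<in> hom_set C X A" and g: "g \<in> hom_set C X A"
  shows "f = g"
proof -
  note objs = hom_objs[OF cat f]
  note Id_A = id_in_hom[OF cat objs(2)]
  have diagonal: "internal_relation C 2 A A (\<lambda>_. Id C A)"
    unfolding internal_relation_def
  proof (intro conjI allI impI)
    fix Y u v
    assume "u \<in> hom_set C Y A" "v \<in> hom_set C Y A"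
      "\<forall>i<2::nat. Comp C (Id C A) u = Comp C (Id C A) v"
    then show "u = v" using comp_id(2)[OF cat] by (metis zero_less_numeral)
  qed (use objs Id_A in auto)
  \<comment> \<open>Truth values select one of the two arrows. Agreement of \<phi> and \<psi> along
    the columns puts all left columns on the diagonal, while the right column consists of
    \<open>f\<close> and \<open>g\<close> in some order.\<close>
  define G where "G t v = (if if t = 0 then \<phi> v else \<psi> v then f else g)" for t :: nat and v
  have G: "G t v \<in> hom_set C X A" for t v using f g by (simp add: G_def)
  have "\<exists>u\<in>hom_set C X A. \<forall>t<2. Comp C (Id C A) u = G t 0"
  proof (rule rowwise_closed[OF cat fc cl M diagonal objs(1), of "\<lambda>t. if t = 0 then i else i'"])
    fix j assume "j < m"
    then have "G t (M $$ (if t = 0 then i else i', j)) = G 0 (M $$ (i, j))" for t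
      using eq by (simp add: G_def)
    then show "\<exists>u\<in>hom_set C X A. \<forall>t<2. Comp C (Id C A) u = G t (M $$ (if t = 0 then i else i', j))"
      using G comp_id(2)[OF cat] by metis
  qed (use i G in auto)
  then have "G 0 0 = G 1 0"
    by (metis one_less_numeral_iff semiring_norm(76) zero_less_numeral)
  then show ?thesis using neq by (auto simp: G_def split: if_splits)
qed

text \<open>A single left column already provides an arrow from \<open>X\<close> to
  \<open>R\<close>, and when parallel arrows coincide it witnesses every tuple. The same fact serves
  positive decisions in Step 1 and the chain that refutes empty matrices.\<close>

lemma thin_closed:
  assumes cat: "is_category C" and N: "\<not> empty_matrix N"
    and thin: "\<And>X A f g. f \<in> hom_set C X A \<Longrightarrow> g \<in> hom_set C X A \<Longrightarrow> f = g"
  shows "has_closed_relations C N"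
proof (rule has_closed_relationsI)
  fix m k A R r X f
  assume R: "internal_relation C (dim_row N) A R r" and "dim_col N = m"
    and f: "\<And>v. v < k \<Longrightarrow> f v \<in> hom_set C X A" "0 < k"
    and left: "\<And>j. j < m \<Longrightarrow> \<exists>u\<in>hom_set C X R. \<forall>i<dim_row N. Comp C (r i) u = f (N $$ (i, j))"
  then obtain u where u: "u \<in> hom_set C X R" using N left[of 0] unfolding empty_matrix_def by blast
  have "Comp C (r i) u = f 0" if "i < dim_row N" for i
    using thin comp_in_hom[OF cat u internal_relationD(3)[OF R that]] f by blast
  then show "\<exists>u\<in>hom_set C X R. \<forall>i<dim_row N. Comp C (r i) u = f 0" using u by blast
qed

section \<open>Linkages\<close>

lemma mod_4_cases:
  fixes t :: nat
  shows "t mod 4 = 0 \<and> Suc t mod 4 = 1 \<and> even t \<or> t mod 4 = 1 \<and> Suc t mod 4 = 2 \<or>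
    t mod 4 = 2 \<and> Suc t mod 4 = 3 \<and> even t \<or> t mod 4 = 3 \<and> Suc t mod 4 = 0"
  by presburger

text \<open>The zeros of the two rows lie in different components of the bipartite graph of values.
  For \<open>i = i'\<close> this holds exactly when the row contains no 0, so one notion covers both
  tests of Step 1.\<close>

definition rows_separable :: "nat mat \<Rightarrow> nat \<Rightarrow> nat \<Rightarrow> bool" where
  "rows_separable M i i' \<longleftrightarrow>
     (\<exists>\<phi> \<psi> :: nat \<Rightarrow> bool. (\<forall>j<dim_col M. \<phi> (M $$ (i, j)) = \<psi> (M $$ (i', j))) \<and> \<phi> 0 \<noteq> \<psi> 0)"

lemma row_without_zero_separable:
  assumes "row_without_zero M"
  obtains i where "i < dim_row M" and "rows_separable M i i"
proof -
  obtain i where i: "i < dim_row M" "\<forall>j<dim_col M. M $$ (i, j) \<noteq> 0"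
    using assms unfolding row_without_zero_def by blast
  have "rows_separable M i i" unfolding rows_separable_def
    by (rule exI[of _ "\<lambda>v. v = 0"], rule exI[of _ "\<lambda>_. False"]) (use i in auto)
  then show thesis using i that by blast
qed

text \<open>In contrast to a linkage, the moves need not alternate between the rows. The reachable
  columns are therefore visibly closed under sharing an entry in either row, which is what
  separating functions require.\<close>

inductive column_linked :: "nat mat \<Rightarrow> nat \<Rightarrow> nat \<Rightarrow> nat \<Rightarrow> nat \<Rightarrow> bool"
  for M i i' j where
  refl: "column_linked M i i' j j"
| first_row: "column_linked M i i' j j1 \<Longrightarrow> j2 < dim_col M \<Longrightarrow> M $$ (i, j1) = M $$ (i, j2) \<Longrightarrow>
    column_linked M i i' j j2"
| second_row: "column_linked M i i' j j1 \<Longrightarrow> j2 < dim_col M \<Longrightarrow> M $$ (i', j1) = M $$ (i', j2) \<Longrightarrow>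
    column_linked M i i' j j2"

text \<open>The rows of such a linkage are determined by the residues modulo 4, so only its columns are recorded.\<close>

definition alternating :: "nat mat \<Rightarrow> nat \<Rightarrow> nat \<Rightarrow> nat \<Rightarrow> nat \<Rightarrow> nat \<Rightarrow> (nat \<Rightarrow> nat) \<Rightarrow> bool" where
  "alternating M i i' j j' l c \<longleftrightarrow> l mod 4 = 1 \<and> c 0 = j \<and> c l = j' \<and> (\<forall>t\<le>l. c t < dim_col M) \<and>
     (\<forall>t<l. (even t \<longrightarrow> c (Suc t) = c t) \<and>
       (t mod 4 = 1 \<longrightarrow> M $$ (i', c t) = M $$ (i', c (Suc t))) \<and>
       (t mod 4 = 3 \<longrightarrow> M $$ (i, c t) = M $$ (i, c (Suc t))))"

text \<open>One period of length 4 permits one change of column in each row, and either change may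
  be trivial: \<open>jx = j1\<close> leaves only a move in the first row, \<open>jx = j2\<close>
  only one in the second. Thus the prescribed alternation does not restrict reachability.\<close>

lemma alternating_extend:
  assumes a: "alternating M i i' j j1 l c" and lt: "jx < dim_col M" "j2 < dim_col M"
    and eq: "M $$ (i', j1) = M $$ (i', jx)" "M $$ (i, jx) = M $$ (i, j2)"
  shows "\<exists>c. alternating M i i' j j2 (l + 4) c"
proof -
  define d where "d t = (if t \<le> l then c t else if t \<le> l + 2 then jx else j2)" for t
  have l: "l mod 4 = 1" using a by (simp add: alternating_def)
  have m: "Suc l mod 4 = 2" "Suc (Suc l) mod 4 = 3" "Suc (Suc (Suc l)) mod 4 = 0"
    using l by presburger+
  have odd: "odd l" "odd (Suc (Suc l))" using l by presburger+
  have "(even t \<longrightarrow> d (Suc t) = d t) \<and>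
       (t mod 4 = 1 \<longrightarrow> M $$ (i', d t) = M $$ (i', d (Suc t))) \<and>
       (t mod 4 = 3 \<longrightarrow> M $$ (i, d t) = M $$ (i, d (Suc t)))" if "t < l + 4" for t
  proof -
    have "t < l \<or> t = l \<or> t = Suc l \<or> t = Suc (Suc l) \<or> t = Suc (Suc (Suc l))"
      using that by linarith
    then consider "t < l" | "t = l" | "t = Suc l" | "t = Suc (Suc l)" | "t = Suc (Suc (Suc l))"
      by blast
    then show ?thesis
    proof cases
      case 1
      then show ?thesis using a by (simp add: alternating_def d_def)
    next
      case 2
      then show ?thesis using a eq odd l by (simp add: alternating_def d_def)
    qed (use m odd eq in \<open>simp_all add: d_def\<close>)
  qed
  moreover have "(l + 4) mod 4 = 1" using l by simp
  moreover have "d 0 = j" "d (l + 4) = j2" using a by (auto simp: alternating_def d_def)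
  moreover have "\<forall>t\<le>l + 4. d t < dim_col M" using a lt by (simp add: alternating_def d_def)
  ultimately show ?thesis unfolding alternating_def by blast
qed

lemma column_linked_linked:
  assumes "column_linked M i i' j j'" and j: "j < dim_col M"
    and i: "i < dim_row M" "i' < dim_row M"
  shows "linked M (i, j) (i', j')"
proof -
  have "j' < dim_col M \<and> (\<exists>l c. alternating M i i' j j' l c)"
    using assms(1)
  proof induction
    case refl
    \<comment> \<open>The shortest linkage passes from the first to the second row inside column
      \<open>j\<close>.\<close>
    have "alternating M i i' j j 1 (\<lambda>_. j)" using j by (auto simp: alternating_def)
    then show ?case using j by blast
  next
    case (first_row j1 j2)
    then show ?case using alternating_extend[of M i i' j j1 _ _ j1 j2] by blast
  next
    case (second_row j1 j2)
    then show ?case using alternating_extend[of M i i' j j1 _ _ j2 j2] by blast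
  qed
  then obtain l c where a: "alternating M i i' j j' l c" by blast
  define r where "r t = (if t mod 4 = 0 \<or> t mod 4 = 3 then i else i')" for t :: nat
  have l: "l mod 4 = 1" "l > 0" using a by (auto simp: alternating_def intro: Nat.gr0I)
  have ends: "r 0 = i" "r l = i'" "c 0 = j" "c l = j'"
    using a l by (auto simp: alternating_def r_def)
  have "(t mod 4 = 0 \<longrightarrow> r t = i \<and> r (t + 1) = i' \<and> c t = c (t + 1)) \<and>
        (t mod 4 = 1 \<longrightarrow> r t = r (t + 1) \<and> r (t + 1) = i' \<and> M $$ (r t, c t) = M $$ (r (t + 1), c (t + 1))) \<and>
        (t mod 4 = 2 \<longrightarrow> r t = i' \<and> r (t + 1) = i \<and> c t = c (t + 1)) \<and>
        (t mod 4 = 3 \<longrightarrow> r t = r (t + 1) \<and> r (t + 1) = i \<and> M $$ (r t, c t) = M $$ (r (t + 1), c (t + 1)))"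
    if t: "t < l" for t
  proof -
    have c: "even t \<Longrightarrow> c (Suc t) = c t" "t mod 4 = 1 \<Longrightarrow> M $$ (i', c t) = M $$ (i', c (Suc t))"
      "t mod 4 = 3 \<Longrightarrow> M $$ (i, c t) = M $$ (i, c (Suc t))"
      using a t unfolding alternating_def by blast+
    consider "t mod 4 = 0" "Suc t mod 4 = 1" "even t" | "t mod 4 = 1" "Suc t mod 4 = 2"
      | "t mod 4 = 2" "Suc t mod 4 = 3" "even t" | "t mod 4 = 3" "Suc t mod 4 = 0"
      using mod_4_cases[of t] by auto
    then show ?thesis using c by cases (simp_all add: r_def)
  qed
  moreover have "\<forall>t\<le>l. r t < dim_row M \<and> c t < dim_col M"
    using a i by (auto simp: alternating_def r_def)
  ultimately have "is_linkage M l r c" unfolding is_linkage_def ends by blast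
  then show ?thesis unfolding linked_def using ends by blast
qed

text \<open>The component of the chosen 0 separates the rows: \<phi> and \<psi> mark the values that
  occur in the two rows in columns reachable from \<open>j\<close>. The first row has a marked 0,
  and a marked 0 in the second row would yield a linkage.\<close>

lemma linkage_test_failure_separable:
  assumes i: "i < dim_row M" "i' < dim_row M" and j: "j < dim_col M" and zero: "M $$ (i, j) = 0"
    and fail: "\<not> linkage_test M i j i'"
  shows "rows_separable M i i'"
proof -
  let ?L = "column_linked M i i' j"
  define \<phi> where "\<phi> v = (\<exists>j'<dim_col M. ?L j' \<and> M $$ (i, j') = v)" for v
  define \<psi> where "\<psi> v = (\<exists>j'<dim_col M. ?L j' \<and> M $$ (i', j') = v)" for v
  have "\<phi> (M $$ (i, j')) = ?L j'" "\<psi> (M $$ (i', j')) = ?L j'" if "j' < dim_col M" for j'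
    unfolding \<phi>_def \<psi>_def using that
    by (blast intro: column_linked.first_row column_linked.second_row)+
  moreover have "\<phi> 0" unfolding \<phi>_def using j zero column_linked.refl by blast
  moreover have "\<not> \<psi> 0"
    using fail column_linked_linked[OF _ j i] unfolding \<psi>_def linkage_test_def by blast
  ultimately show ?thesis unfolding rows_separable_def
    by (intro exI[of _ \<phi>] exI[of _ \<psi>]) simp
qed

lemma linkage_test_not_separable:
  assumes zero: "M $$ (i, j) = 0" and test: "linkage_test M i j i'" and ne: "i \<noteq> i'"
    and eq: "\<And>j. j < dim_col M \<Longrightarrow> \<phi> (M $$ (i, j)) = \<psi> (M $$ (i', j))"
  shows "\<phi> 0 = \<psi> 0"
proof -
  obtain j' where "j' < dim_col M" and zero': "M $$ (i', j') = 0" and "linked M (i, j) (i', j')"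
    using test unfolding linkage_test_def by blast
  then obtain l r c where link: "is_linkage M l r c" and ends: "r 0 = i" "c 0 = j" "r l = i'" "c l = j'"
    unfolding linked_def by auto
  note L = link[unfolded is_linkage_def ends]
  \<comment> \<open>The value \<phi> 0 is carried along the linkage, read through \<phi> in the
    first row and through \<psi> in the second. A step inside a column switches between the
    readings, and a step inside a row keeps the entry.\<close>
  have "if t mod 4 = 0 \<or> t mod 4 = 3 then r t = i \<and> \<phi> (M $$ (i, c t)) = \<phi> 0
    else r t = i' \<and> \<psi> (M $$ (i', c t)) = \<phi> 0" if "t \<le> l" for t
    using that
  proof (induction t)
    case 0
    then show ?case using ends zero by simp
  next
    case (Suc t)
    have col: "\<phi> (M $$ (i, c t)) = \<psi> (M $$ (i', c t))" using eq L Suc.prems by simp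
    have IH: "if t mod 4 = 0 \<or> t mod 4 = 3 then r t = i \<and> \<phi> (M $$ (i, c t)) = \<phi> 0
      else r t = i' \<and> \<psi> (M $$ (i', c t)) = \<phi> 0" using Suc by simp
    have t: "t < l" using Suc.prems by simp
    note link_t = L[THEN conjunct2, THEN spec, THEN mp, OF t]
    consider "t mod 4 = 0" "Suc t mod 4 = 1" | "t mod 4 = 1" "Suc t mod 4 = 2"
      | "t mod 4 = 2" "Suc t mod 4 = 3" | "t mod 4 = 3" "Suc t mod 4 = 0"
      using mod_4_cases[of t] by auto
    then show ?case
    proof cases
      case 1
      then have "r (Suc t) = i'" "c (Suc t) = c t" using link_t by auto
      then show ?thesis using IH 1 col by simp
    next
      case 2
      then have "r t = i'" "r (Suc t) = i'" "M $$ (i', c t) = M $$ (i', c (Suc t))"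
        using link_t by auto
      then show ?thesis using IH 2 by simp
    next
      case 3
      then have "r (Suc t) = i" "c (Suc t) = c t" using link_t by auto
      then show ?thesis using IH 3 col by simp
    next
      case 4
      then have "r t = i" "r (Suc t) = i" "M $$ (i, c t) = M $$ (i, c (Suc t))"
        using link_t by auto
      then show ?thesis using IH 4 by simp
    qed
  qed
  \<comment> \<open>Since the rows are distinct, the linkage cannot end at a residue belonging to
    the first row, so the second reading applies to the final 0.\<close>
  from this[of l] show ?thesis using ends zero' ne by (auto split: if_splits)
qed

section \<open>The category of row-closed structures\<close>

text \<open>The choice \<sigma> of rows encodes a matrix \<open>M'\<close> built from rows of
  \<open>M\<close>, so the arity \<open>n\<close> may differ from the number of rows of
  \<open>M\<close>. Leaving \<open>g\<close> unbounded makes preimages under arbitrary maps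
  row-closed; in return, boundedness of \<open>g i 0\<close> has to come from zeros in the
  rows.\<close>

definition row_closed :: "nat mat set \<Rightarrow> nat \<Rightarrow> nat list set \<Rightarrow> bool" where
  "row_closed S n Q \<longleftrightarrow>
     (\<forall>M\<in>S. \<forall>\<sigma> g. (\<forall>i<n. \<sigma> i < dim_row M) \<longrightarrow>
        (\<forall>j<dim_col M. map (\<lambda>i. g i (M $$ (\<sigma> i, j))) [0..<n] \<in> Q) \<longrightarrow>
        map (\<lambda>i. g i 0) [0..<n] \<in> Q)"

definition row_closure :: "nat mat set \<Rightarrow> nat \<Rightarrow> nat list set \<Rightarrow> nat list set" where
  "row_closure S n Q = \<Inter> {T. Q \<subseteq> T \<and> row_closed S n T}"

definition tuples :: "nat \<Rightarrow> nat \<Rightarrow> nat list set" where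
  "tuples n p = {xs. length xs = n \<and> set xs \<subseteq> {..<p}}"

lemma row_closedD:
  assumes "row_closed S n Q" and "M \<in> S" and "\<And>i. i < n \<Longrightarrow> \<sigma> i < dim_row M"
    and "\<And>j. j < dim_col M \<Longrightarrow> map (\<lambda>i. g i (M $$ (\<sigma> i, j))) [0..<n] \<in> Q"
  shows "map (\<lambda>i. g i 0) [0..<n] \<in> Q"
  using assms unfolding row_closed_def by blast

lemma row_closedI:
  assumes "\<And>M \<sigma> g. M \<in> S \<Longrightarrow> (\<And>i. i < n \<Longrightarrow> \<sigma> i < dim_row M) \<Longrightarrow>
    (\<And>j. j < dim_col M \<Longrightarrow> map (\<lambda>i. g i (M $$ (\<sigma> i, j))) [0..<n] \<in> Q) \<Longrightarrow>
    map (\<lambda>i. g i 0) [0..<n] \<in> Q"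
  shows "row_closed S n Q"
  using assms unfolding row_closed_def by blast

lemma finite_tuples: "finite (tuples n p)"
  unfolding tuples_def using finite_lists_length_eq[of "{..<p}" n] by (simp add: conj_commute)

lemma row_closed_row_closure: "row_closed S n (row_closure S n Q)"
proof (rule row_closedI)
  fix M \<sigma> g
  assume M: "M \<in> S" "\<And>i. i < n \<Longrightarrow> \<sigma> i < dim_row M"
    and left: "\<And>j. j < dim_col M \<Longrightarrow> map (\<lambda>i. g i (M $$ (\<sigma> i, j))) [0..<n] \<in> row_closure S n Q"
  have "map (\<lambda>i. g i 0) [0..<n] \<in> T" if T: "Q \<subseteq> T" "row_closed S n T" for T
    by (rule row_closedD[OF T(2) M]) (use left T in \<open>auto simp: row_closure_def\<close>)
  then show "map (\<lambda>i. g i 0) [0..<n] \<in> row_closure S n Q" unfolding row_closure_def by blast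
qed

lemma row_closure_superset: "Q \<subseteq> row_closure S n Q"
  unfolding row_closure_def by blast

lemma row_closure_least: "Q \<subseteq> T \<Longrightarrow> row_closed S n T \<Longrightarrow> row_closure S n Q \<subseteq> T"
  unfolding row_closure_def by blast

lemma row_closed_preimage:
  assumes "row_closed S n T"
  shows "row_closed S n {xs. map f xs \<in> T}"
proof (rule row_closedI)
  fix M \<sigma> g
  assume M: "M \<in> S" "\<And>i. i < n \<Longrightarrow> \<sigma> i < dim_row M"
    and "\<And>j. j < dim_col M \<Longrightarrow> map (\<lambda>i. g i (M $$ (\<sigma> i, j))) [0..<n] \<in> {xs. map f xs \<in> T}"
  then show "map (\<lambda>i. g i 0) [0..<n] \<in> {xs. map f xs \<in> T}"
    using row_closedD[OF assms M, where g = "\<lambda>i v. f (g i v)"] by (simp add: comp_def)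
qed

text \<open>Relations are lists instead of sets so that objects and arrows have countable types, as
  the transport to arbitrary infinite types requires. Lists with the same elements give isomorphic
  objects.\<close>

type_synonym rel_structure = "nat \<times> nat list list"

text \<open>An object is a structure with carrier \<open>{..<p}\<close> and an \<open>n\<close>-ary relation. An arrow \<open>(a, b, fs)\<close>
  from \<open>a\<close> to \<open>b\<close> is a homomorphism of structures in the opposite direction, which maps \<open>x\<close> to \<open>fs ! x\<close>.\<close>

definition str_objs :: "nat mat set \<Rightarrow> nat \<Rightarrow> rel_structure set" where
  "str_objs S n = {(p, \<Phi>). set \<Phi> \<subseteq> tuples n p \<and> row_closed S n (set \<Phi>)}"

definition str_hom :: "rel_structure \<Rightarrow> rel_structure \<Rightarrow> nat list \<Rightarrow> bool" where
  "str_hom a b fs \<longleftrightarrow> fs \<in> tuples (fst b) (fst a) \<and>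
     (\<forall>xs\<in>set (snd b). map ((!) fs) xs \<in> set (snd a))"

definition str_cat :: "nat mat set \<Rightarrow> nat \<Rightarrow> (rel_structure, rel_structure \<times> rel_structure \<times> nat list) category_data" where
  "str_cat S n = \<lparr>Obj = str_objs S n,
     Arr = {(a, b, fs). a \<in> str_objs S n \<and> b \<in> str_objs S n \<and> str_hom a b fs},
     Dom = fst, Cod = (\<lambda>f. fst (snd f)), Id = (\<lambda>a. (a, a, [0..<fst a])),
     Comp = (\<lambda>g f. (fst f, fst (snd g), map ((!) (snd (snd f))) (snd (snd g))))\<rparr>"

lemma str_cat_simps [simp]:
  "Obj (str_cat S n) = str_objs S n"
  "Id (str_cat S n) a = (a, a, [0..<fst a])"
  "Comp (str_cat S n) (b', c, gs) (a, b, fs) = (a, c, map ((!) fs) gs)"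
  by (simp_all add: str_cat_def)

lemma str_cat_hom_iff:
  "f \<in> hom_set (str_cat S n) a b \<longleftrightarrow>
     a \<in> str_objs S n \<and> b \<in> str_objs S n \<and> (\<exists>fs. f = (a, b, fs) \<and> str_hom a b fs)"
  by (cases f) (auto simp: str_cat_def hom_set_def)

lemma tuples_nth: "xs \<in> tuples n p \<Longrightarrow> i < n \<Longrightarrow> xs ! i < p"
  unfolding tuples_def using nth_mem by fastforce

lemma tuplesI: "length xs = n \<Longrightarrow> (\<And>i. i < n \<Longrightarrow> xs ! i < p) \<Longrightarrow> xs \<in> tuples n p"
  by (auto simp: tuples_def in_set_conv_nth)

lemma str_objs_tuples: "a \<in> str_objs S n \<Longrightarrow> xs \<in> set (snd a) \<Longrightarrow> xs \<in> tuples n (fst a)"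
  by (auto simp: str_objs_def)

lemma str_hom_tuples: "str_hom a b fs \<Longrightarrow> fs \<in> tuples (fst b) (fst a)"
  by (simp add: str_hom_def)

lemma str_hom_comp:
  assumes "b \<in> str_objs S n" and c: "c \<in> str_objs S n" and f: "str_hom a b fs" and g: "str_hom b c gs"
  shows "str_hom a c (map ((!) fs) gs)"
  unfolding str_hom_def
proof (intro conjI ballI)
  show "map ((!) fs) gs \<in> tuples (fst c) (fst a)"
    using str_hom_tuples[OF g] tuples_nth[OF str_hom_tuples[OF f]]
    by (auto simp: tuples_def)
  fix xs assume xs: "xs \<in> set (snd c)"
  then have "xs \<in> tuples n (length gs)"
    using str_objs_tuples[OF c] str_hom_tuples[OF g] by (simp add: tuples_def)
  then have "map ((!) (map ((!) fs) gs)) xs = map ((!) fs) (map ((!) gs) xs)"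
    by (auto simp: tuples_def)
  moreover have "map ((!) gs) xs \<in> set (snd b)" using g xs by (simp add: str_hom_def)
  ultimately show "map ((!) (map ((!) fs) gs)) xs \<in> set (snd a)"
    using f unfolding str_hom_def by metis
qed

lemma str_cat_is_category: "is_category (str_cat S n)"
  unfolding is_category_def
proof (intro conjI ballI allI impI)
  fix f assume "f \<in> Arr (str_cat S n)"
  then show "Dom (str_cat S n) f \<in> Obj (str_cat S n)" "Cod (str_cat S n) f \<in> Obj (str_cat S n)"
    by (auto simp: str_cat_def)
next
  fix a assume a: "a \<in> Obj (str_cat S n)"
  have "map ((!) [0..<fst a]) xs = xs" if "xs \<in> set (snd a)" for xs
    using str_objs_tuples[of a S n xs] a that by (auto simp: tuples_def intro!: map_idI)
  then show "Id (str_cat S n) a \<in> hom_set (str_cat S n) a a"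
    using a by (auto simp: str_cat_hom_iff str_hom_def intro: tuplesI)
next
  fix a b c f g
  assume "f \<in> hom_set (str_cat S n) a b" "g \<in> hom_set (str_cat S n) b c"
  then show "Comp (str_cat S n) g f \<in> hom_set (str_cat S n) a c"
    by (auto simp: str_cat_hom_iff intro: str_hom_comp)
next
  fix a b f
  assume "f \<in> hom_set (str_cat S n) a b"
  then obtain fs where f: "f = (a, b, fs)" and fs: "fs \<in> tuples (fst b) (fst a)"
    using str_hom_tuples unfolding str_cat_hom_iff by blast
  show "Comp (str_cat S n) f (Id (str_cat S n) a) = f"
    using fs by (auto simp: f tuples_nth tuples_def intro!: nth_equalityI)
  show "Comp (str_cat S n) (Id (str_cat S n) b) f = f"
    using fs by (auto simp: f tuples_def intro!: nth_equalityI)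
next
  fix a b c d f g h
  assume "f \<in> hom_set (str_cat S n) a b" "g \<in> hom_set (str_cat S n) b c" "h \<in> hom_set (str_cat S n) c d"
  then obtain fs gs hs where *: "f = (a, b, fs)" "g = (b, c, gs)" "h = (c, d, hs)"
    and "hs \<in> tuples (fst d) (fst c)" "gs \<in> tuples (fst c) (fst b)"
    using str_hom_tuples unfolding str_cat_hom_iff by blast
  then show "Comp (str_cat S n) h (Comp (str_cat S n) g f) = Comp (str_cat S n) (Comp (str_cat S n) h g) f"
    by (auto simp: tuples_def)
qed

section \<open>Finite limits as quotients of disjoint unions of structures\<close>

lemma rtrancl_sym_invariant:
  assumes "(w, w') \<in> (E \<union> E\<inverse>)\<^sup>*" and "\<And>a b. (a, b) \<in> E \<Longrightarrow> h a = h b"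
  shows "h w = h w'"
  using assms(1) by induction (use assms(2) in auto)

text \<open>Carriers must be initial segments of the naturals, so the classes of the generated
  equivalence relation are numbered.\<close>

lemma quotient_enumeration:
  fixes E :: "'a rel"
  assumes "finite W"
  obtains q :: "'a \<Rightarrow> nat" and p where "q ` W = {..<p}"
    and "\<forall>w\<in>W. \<forall>w'\<in>W. q w = q w' \<longleftrightarrow> (w, w') \<in> (E \<union> E\<inverse>)\<^sup>*"
proof -
  define R where "R = (E \<union> E\<inverse>)\<^sup>*"
  have "sym R" unfolding R_def by (intro sym_rtrancl sym_Un_converse)
  moreover have "trans R" "refl R" by (simp_all add: R_def trans_rtrancl refl_rtrancl)
  ultimately have cls: "R `` {w} = R `` {w'} \<longleftrightarrow> (w, w') \<in> R" for w w'
    using eq_equiv_class_iff[of UNIV R w w'] by (simp add: equiv_def)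
  obtain h where h: "bij_betw h ((\<lambda>w. R `` {w}) ` W) {0..<card ((\<lambda>w. R `` {w}) ` W)}"
    using ex_bij_betw_finite_nat[of "(\<lambda>w. R `` {w}) ` W"] assms by auto
  let ?q = "\<lambda>w. h (R `` {w})"
  show thesis
  proof (rule that[of ?q])
    show "?q ` W = {..<card ((\<lambda>w. R `` {w}) ` W)}"
      using bij_betw_imp_surj_on[OF h] by (auto simp: image_image)
    have "?q w = ?q w' \<longleftrightarrow> R `` {w} = R `` {w'}" if "w \<in> W" "w' \<in> W" for w w'
      using inj_on_eq_iff[OF bij_betw_imp_inj_on[OF h]] that by blast
    then show "\<forall>w\<in>W. \<forall>w'\<in>W. ?q w = ?q w' \<longleftrightarrow> (w, w') \<in> (E \<union> E\<inverse>)\<^sup>*"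
      unfolding cls unfolding R_def by blast
  qed
qed

text \<open>The tuples that a map sends into a row-closed relation form a row-closed set, so a map
  out of a generated structure needs checking on generators only.\<close>

lemma str_hom_row_closure:
  assumes a: "a \<in> str_objs S n" and fs: "fs \<in> tuples p (fst a)"
    and \<Phi>: "set \<Phi> = row_closure S n G" and G: "\<And>xs. xs \<in> G \<Longrightarrow> map ((!) fs) xs \<in> set (snd a)"
  shows "str_hom a (p, \<Phi>) fs"
proof -
  have "row_closed S n {xs. map ((!) fs) xs \<in> set (snd a)}"
    using a by (intro row_closed_preimage) (auto simp: str_objs_def)
  then have "row_closure S n G \<subseteq> {xs. map ((!) fs) xs \<in> set (snd a)}"
    using G by (intro row_closure_least) auto
  then show ?thesis using fs \<Phi> by (auto simp: str_hom_def)
qed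

text \<open>Limits here are colimits of structures: the disjoint union of the carriers modulo the
  maps of the diagram, with the row-closed relation generated by the images of the given
  tuples.\<close>

lemma str_cat_finitely_complete:
  assumes full: "\<And>p. row_closed S n (tuples n p)"
  shows "finitely_complete (str_cat S n)"
  unfolding finitely_complete_def
proof (intro allI impI)
  fix J :: "(nat, nat) category_data" and F F'
  assume J: "is_category J" and fin: "finite (Arr J)" and func: "is_functor J (str_cat S n) F F'"
  let ?C = "str_cat S n"
  have "Obj J \<subseteq> Dom J ` Arr J"
    using id_in_hom[OF J] by (force simp: hom_set_def)
  then have finO: "finite (Obj J)" using fin finite_surj by blast
  have F: "F i \<in> str_objs S n" if "i \<in> Obj J" for i
    using func that by (simp add: is_functor_def)
  define fs where "fs u = snd (snd (F' u))" for u
  have F': "F' u = (F i, F j, fs u)" "str_hom (F i) (F j) (fs u)" if "u \<in> hom_set J i j" for i j u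
  proof -
    have "F' u \<in> hom_set ?C (F i) (F j)" using func that unfolding is_functor_def by blast
    then show "F' u = (F i, F j, fs u)" "str_hom (F i) (F j) (fs u)"
      by (auto simp: str_cat_hom_iff fs_def)
  qed
  define W where "W = Sigma (Obj J) (\<lambda>i. {..<fst (F i)})"
  \<comment> \<open>An arrow \<open>u\<close> from \<open>i\<close> to \<open>j\<close> is a map of
    carriers from \<open>F j\<close> to \<open>F i\<close>; it identifies each point
    \<open>y\<close> with its image.\<close>
  define E where "E = {((j, y), (i, fs u ! y)) | i j u y. u \<in> hom_set J i j \<and> y < fst (F j)}"
  have finW: "finite W" using finO by (simp add: W_def)
  obtain q and p :: nat where surj: "q ` W = {..<p}"
    and q': "\<forall>w\<in>W. \<forall>w'\<in>W. q w = q w' \<longleftrightarrow> (w, w') \<in> (E \<union> E\<inverse>)\<^sup>*"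
    by (rule quotient_enumeration[OF finW, of E])
  have q: "q w = q w' \<longleftrightarrow> (w, w') \<in> (E \<union> E\<inverse>)\<^sup>*" if "w \<in> W" "w' \<in> W" for w w'
    using q' that by blast
  have q_lt: "q (i, x) < p" if "i \<in> Obj J" "x < fst (F i)" for i x
    using surj that by (auto simp: W_def)
  have q_E: "q (j, y) = q (i, fs u ! y)" if u: "u \<in> hom_set J i j" and y: "y < fst (F j)" for i j u y
  proof -
    have "i \<in> Obj J" "j \<in> Obj J" using hom_objs[OF J u] by simp_all
    moreover have "fs u ! y < fst (F i)" using tuples_nth[OF str_hom_tuples[OF F'(2)[OF u]] y] .
    ultimately show ?thesis using q[of "(j, y)" "(i, fs u ! y)"] u y by (auto simp: W_def E_def)
  qed
  define G where "G = (\<Union>i\<in>Obj J. map (\<lambda>x. q (i, x)) ` set (snd (F i)))"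
  have "map (\<lambda>x. q (i, x)) xs \<in> tuples n p" if "i \<in> Obj J" "xs \<in> set (snd (F i))" for i xs
    using str_objs_tuples[OF F[OF that(1)] that(2)] q_lt[OF that(1)] by (auto simp: tuples_def)
  then have "G \<subseteq> tuples n p" unfolding G_def by blast
  \<comment> \<open>Row-closedness of the full relation keeps the closure inside the finite carrier;
    otherwise the generated relation need not belong to an object.\<close>
  then have cl: "row_closure S n G \<subseteq> tuples n p" using full by (rule row_closure_least)
  then have "finite (row_closure S n G)" using finite_tuples by (rule finite_subset)
  then obtain \<Phi> where \<Phi>: "set \<Phi> = row_closure S n G" using finite_list by blast
  define L where "L = (p, \<Phi>)"
  have L: "L \<in> str_objs S n" using cl \<Phi> row_closed_row_closure by (simp add: L_def str_objs_def)
  define ps where "ps i = map (\<lambda>x. q (i, x)) [0..<fst (F i)]" for i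
  have ps: "str_hom L (F i) (ps i)" if i: "i \<in> Obj J" for i
    unfolding str_hom_def
  proof (intro conjI ballI)
    show "ps i \<in> tuples (fst (F i)) (fst L)" using q_lt[OF i] by (auto simp: ps_def L_def tuples_def)
    fix xs assume xs: "xs \<in> set (snd (F i))"
    have "map ((!) (ps i)) xs = map (\<lambda>x. q (i, x)) xs"
      using str_objs_tuples[OF F[OF i] xs] by (auto simp: ps_def tuples_def)
    also have "\<dots> \<in> G" using i xs by (auto simp: G_def)
    finally show "map ((!) (ps i)) xs \<in> set (snd L)"
      using row_closure_superset \<Phi> by (auto simp: L_def)
  qed
  define pr where "pr i = (L, F i, ps i)" for i
  have "is_cone J ?C F F' L pr"
    unfolding is_cone_def
  proof (intro conjI ballI allI impI)
    fix i j u assume u: "u \<in> hom_set J i j"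
    have t: "fs u \<in> tuples (fst (F j)) (fst (F i))" using str_hom_tuples[OF F'(2)[OF u]] .
    then have "map ((!) (ps i)) (fs u) = ps j"
      using q_E[OF u] tuples_nth[OF t] by (intro nth_equalityI) (auto simp: ps_def tuples_def)
    then show "Comp ?C (F' u) (pr i) = pr j" using F'(1)[OF u] by (simp add: pr_def)
  qed (use L F ps in \<open>auto simp: str_cat_hom_iff pr_def\<close>)
  moreover have "\<exists>!h. h \<in> hom_set ?C X L \<and> (\<forall>i\<in>Obj J. Comp ?C (pr i) h = r i)"
    if cone: "is_cone J ?C F F' X r" for X r
  proof -
    have X: "X \<in> str_objs S n" using cone by (simp add: is_cone_def)
    define rs where "rs i = snd (snd (r i))" for i
    have r: "r i = (X, F i, rs i)" "str_hom X (F i) (rs i)" if "i \<in> Obj J" for i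
      using cone that by (auto simp: is_cone_def str_cat_hom_iff rs_def)
    \<comment> \<open>The legs of a cone are maps into the carrier of \<open>X\<close>; together
      they form one map on the disjoint union, constant along \<open>E\<close>, which descends to
      the quotient.\<close>
    define h where "h w = rs (fst w) ! snd w" for w
    have h_E: "h w = h w'" if "(w, w') \<in> E" for w w'
    proof -
      obtain i j u y where u: "u \<in> hom_set J i j" and y: "y < fst (F j)"
        and w: "w = (j, y)" "w' = (i, fs u ! y)" using \<open>(w, w') \<in> E\<close> unfolding E_def by blast
      have "Comp ?C (F' u) (r i) = r j" using cone u unfolding is_cone_def by blast
      then have "rs j = map ((!) (rs i)) (fs u)"
        using F'(1)[OF u] r(1) hom_objs[OF J u] by simp
      moreover have "length (fs u) = fst (F j)"
        using str_hom_tuples[OF F'(2)[OF u]] by (simp add: tuples_def)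
      ultimately show ?thesis using y by (simp add: h_def w)
    qed
    define g where "g = inv_into W q"
    have g: "g z \<in> W" "q (g z) = z" if "z < p" for z
      using that surj unfolding g_def by (metis inv_into_into lessThan_iff, metis f_inv_into_f lessThan_iff)
    define ws where "ws = map (\<lambda>z. h (g z)) [0..<p]"
    have ws: "ws ! q w = h w" if w: "w \<in> W" for w
    proof -
      have lt: "q w < p" using surj w by auto
      have "(g (q w), w) \<in> (E \<union> E\<inverse>)\<^sup>*" using q[OF g(1)[OF lt] w] g(2)[OF lt] by simp
      then have "h (g (q w)) = h w" using rtrancl_sym_invariant h_E by metis
      then show ?thesis using lt by (simp add: ws_def)
    qed
    have h_lt: "h w < fst X" if "w \<in> W" for w
      using that tuples_nth[OF str_hom_tuples[OF r(2)]] by (auto simp: W_def h_def)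
    have hom: "str_hom X L ws" unfolding L_def
    proof (rule str_hom_row_closure[OF X _ \<Phi>])
      show "ws \<in> tuples p (fst X)" using h_lt[OF g(1)] by (auto simp: ws_def tuples_def)
      fix xs assume "xs \<in> G"
      then obtain i ys where i: "i \<in> Obj J" and ys: "ys \<in> set (snd (F i))"
        and xs: "xs = map (\<lambda>x. q (i, x)) ys" by (auto simp: G_def)
      have "map ((!) ws) xs = map ((!) (rs i)) ys"
        using ws i str_objs_tuples[OF F[OF i] ys] by (auto simp: xs W_def h_def tuples_def)
      then show "map ((!) ws) xs \<in> set (snd X)" using r(2)[OF i] ys by (simp add: str_hom_def)
    qed
    show ?thesis
    proof (rule ex1I[of _ "(X, L, ws)"], intro conjI ballI)
      show "(X, L, ws) \<in> hom_set ?C X L" using X L hom by (simp add: str_cat_hom_iff)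
    next
      fix i assume i: "i \<in> Obj J"
      have "length (rs i) = fst (F i)" using str_hom_tuples[OF r(2)[OF i]] by (simp add: tuples_def)
      then have "map ((!) ws) (ps i) = rs i"
        using ws i by (intro nth_equalityI) (auto simp: ps_def W_def h_def)
      then show "Comp ?C (pr i) (X, L, ws) = r i" using r(1)[OF i] by (simp add: pr_def)
    next
      fix k assume k: "k \<in> hom_set ?C X L \<and> (\<forall>i\<in>Obj J. Comp ?C (pr i) k = r i)"
      then obtain vs where vs: "k = (X, L, vs)" "str_hom X L vs" by (auto simp: str_cat_hom_iff)
      have "vs ! z = ws ! z" if z: "z < p" for z
      proof -
        obtain i x where i: "i \<in> Obj J" and x: "x < fst (F i)" and gz: "g z = (i, x)"
          using g(1)[OF z] by (auto simp: W_def)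
        have "Comp ?C (pr i) k = r i" using k i by blast
        then have "map ((!) vs) (ps i) = rs i" using r(1)[OF i] by (simp add: pr_def vs(1))
        then have "map ((!) vs) (ps i) ! x = rs i ! x" by simp
        then have "vs ! q (i, x) = h (i, x)" using x by (simp add: ps_def h_def)
        then show ?thesis using g(2)[OF z] gz z by (simp add: ws_def)
      qed
      moreover have "length vs = p" "length ws = p"
        using str_hom_tuples[OF vs(2)] by (simp_all add: tuples_def L_def ws_def)
      ultimately show "k = (X, L, ws)" by (auto simp: vs intro: nth_equalityI)
    qed
  qed
  ultimately show "\<exists>L p. is_limit J ?C F F' L p" unfolding is_limit_def by blast
qed

section \<open>Closed and non-closed relations in the category of structures\<close>

lemma rows_not_separable:
  assumes "\<not> rows_separable M i i'" and "\<And>j. j < dim_col M \<Longrightarrow> \<phi> (M $$ (i, j)) = \<psi> (M $$ (i', j))"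
  shows "\<phi> 0 = \<psi> 0"
proof (rule ccontr)
  assume "\<phi> 0 \<noteq> \<psi> 0"
  then have "rows_separable M i i'"
    unfolding rows_separable_def using assms(2)
    \<comment> \<open>Comparing all values with \<open>\<phi> 0\<close> reduces functions into any
      type to Boolean ones.\<close>
    by (intro exI[of _ "\<lambda>v. \<phi> v = \<phi> 0"] exI[of _ "\<lambda>v. \<psi> v = \<phi> 0"]) auto
  then show False using assms(1) by blast
qed

lemma zero_in_row:
  assumes "\<not> rows_separable M i i"
  obtains j where "j < dim_col M" and "M $$ (i, j) = 0"
  using rows_not_separable[OF assms, of "\<lambda>v. v = 0" "\<lambda>_. False"] by auto

text \<open>Row \<open>\<sigma> i\<close> contains a 0, so \<open>g i 0\<close> already occurs as
  the \<open>i\<close>-th entry of some left column and inherits its bound. The same argument fixes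
  every entry in the case of a singleton.\<close>

lemma row_closed_tuples:
  assumes sep: "\<And>M i. M \<in> S \<Longrightarrow> i < dim_row M \<Longrightarrow> \<not> rows_separable M i i" and n: "0 < n"
  shows "row_closed S n (tuples n p)"
proof (rule row_closedI)
  fix M \<sigma> and g :: "nat \<Rightarrow> nat \<Rightarrow> nat"
  assume M: "M \<in> S" and \<sigma>: "\<And>i. i < n \<Longrightarrow> \<sigma> i < dim_row M"
    and left: "\<And>j. j < dim_col M \<Longrightarrow> map (\<lambda>i. g i (M $$ (\<sigma> i, j))) [0..<n] \<in> tuples n p"
  have "g i 0 < p" if i: "i < n" for i
  proof -
    obtain j where "j < dim_col M" "M $$ (\<sigma> i, j) = 0" using zero_in_row[OF sep[OF M \<sigma>[OF i]]] .
    then show ?thesis using tuples_nth[OF left i] i by fastforce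
  qed
  then show "map (\<lambda>i. g i 0) [0..<n] \<in> tuples n p" by (auto simp: tuples_def)
qed

lemma row_closed_singleton:
  assumes sep: "\<And>M i. M \<in> S \<Longrightarrow> i < dim_row M \<Longrightarrow> \<not> rows_separable M i i" and n: "0 < n"
    and xs: "length xs = n"
  shows "row_closed S n {xs}"
proof (rule row_closedI)
  fix M \<sigma> and g :: "nat \<Rightarrow> nat \<Rightarrow> nat"
  assume M: "M \<in> S" and \<sigma>: "\<And>i. i < n \<Longrightarrow> \<sigma> i < dim_row M"
    and left: "\<And>j. j < dim_col M \<Longrightarrow> map (\<lambda>i. g i (M $$ (\<sigma> i, j))) [0..<n] \<in> {xs}"
  have "g i 0 = xs ! i" if i: "i < n" for i
  proof -
    obtain j where j: "j < dim_col M" "M $$ (\<sigma> i, j) = 0" using zero_in_row[OF sep[OF M \<sigma>[OF i]]] .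
    have "map (\<lambda>i. g i (M $$ (\<sigma> i, j))) [0..<n] ! i = xs ! i" using left[OF j(1)] by simp
    then show ?thesis using i j by simp
  qed
  then show "map (\<lambda>i. g i 0) [0..<n] \<in> {xs}" using xs by (auto intro: nth_equalityI)
qed

text \<open>A 0 in some row provides a column, so the condition on left columns cannot hold
  vacuously.\<close>

lemma row_closed_empty:
  assumes sep: "\<And>M i. M \<in> S \<Longrightarrow> i < dim_row M \<Longrightarrow> \<not> rows_separable M i i" and n: "0 < n"
  shows "row_closed S n {}"
proof (rule row_closedI)
  fix M \<sigma> and g :: "nat \<Rightarrow> nat \<Rightarrow> nat"
  assume M: "M \<in> S" and \<sigma>: "\<And>i. i < n \<Longrightarrow> \<sigma> i < dim_row M"
    and left: "\<And>j. j < dim_col M \<Longrightarrow> map (\<lambda>i. g i (M $$ (\<sigma> i, j))) [0..<n] \<in> {}"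
  obtain j where "j < dim_col M" using zero_in_row[OF sep[OF M \<sigma>[OF n]]] .
  then show "map (\<lambda>i. g i 0) [0..<n] \<in> {}" using left by blast
qed

text \<open>If \<open>z\<close> were outside the joint image, then the constant map and the characteristic function of \<open>{z}\<close>
  into \<open>{0, 1}\<close> with the full relation would violate joint monicity.\<close>

lemma jointly_surjective:
  assumes full: "\<And>p. row_closed S n (tuples n p)"
    and R: "internal_relation (str_cat S n) N A R r" and z: "z < fst R"
  shows "\<exists>i x. i < N \<and> x < fst A \<and> snd (snd (r i)) ! x = z"
proof (rule ccontr)
  assume "\<not> ?thesis"
  then have miss: "snd (snd (r i)) ! x \<noteq> z" if "i < N" "x < fst A" for i x using that by blast
  obtain \<Phi> where \<Phi>: "set \<Phi> = tuples n 2" using finite_list[OF finite_tuples] by blast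
  define T where "T = (2 :: nat, \<Phi>)"
  have T: "T \<in> str_objs S n" using full[of 2] \<Phi> by (simp add: T_def str_objs_def)
  have Robj: "R \<in> str_objs S n" using internal_relationD(1)[OF R] by simp
  have hom: "(T, R, us) \<in> hom_set (str_cat S n) T R" if us: "us \<in> tuples (fst R) 2" for us
  proof -
    have "map ((!) us) xs \<in> tuples n 2" if "xs \<in> set (snd R)" for xs
      using str_objs_tuples[OF Robj that] tuples_nth[OF us] by (auto simp: tuples_def)
    then show ?thesis using T Robj us \<Phi> by (auto simp: str_cat_hom_iff str_hom_def T_def)
  qed
  define u v where "u = replicate (fst R) (0 :: nat)" and "v = u[z := 1]"
  have uv: "u \<in> tuples (fst R) 2" "v \<in> tuples (fst R) 2"
    using z by (auto simp: u_def v_def nth_list_update intro!: tuplesI)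
  have "(T, R, u) = (T, R, v)"
  proof (rule internal_relationD(4)[OF R hom[OF uv(1)] hom[OF uv(2)]])
    fix i assume i: "i < N"
    obtain rs where r: "r i = (R, A, rs)" "str_hom R A rs"
      using internal_relationD(3)[OF R i] by (auto simp: str_cat_hom_iff)
    have rs: "rs \<in> tuples (fst A) (fst R)" using str_hom_tuples[OF r(2)] .
    have "map ((!) u) rs = map ((!) v) rs"
    proof (rule nth_equalityI)
      fix x assume "x < length (map ((!) u) rs)"
      then have x: "x < fst A" using rs by (simp add: tuples_def)
      have "rs ! x \<noteq> z" using miss[OF i x] r by simp
      then show "map ((!) u) rs ! x = map ((!) v) rs ! x"
        using x rs by (simp add: v_def tuples_def)
    qed simp
    then show "Comp (str_cat S n) (r i) (T, R, u) = Comp (str_cat S n) (r i) (T, R, v)"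
      using r by simp
  qed
  moreover have "u ! z = 0" "v ! z = 1" using z by (simp_all add: u_def v_def)
  ultimately show False by simp
qed

text \<open>The maps of a relation cover the carrier of \<open>R\<close>, so the required map must
  send \<open>rs i ! x\<close> to \<open>fs 0 ! x\<close> and is determined. Non-separability makes
  this well defined, and row-closedness of \<open>X\<close> makes it a homomorphism.\<close>

lemma str_cat_closed:
  assumes sep: "\<And>M i i'. M \<in> S \<Longrightarrow> i < dim_row M \<Longrightarrow> i' < dim_row M \<Longrightarrow> \<not> rows_separable M i i'"
    and n: "0 < n" and M: "M \<in> S"
  shows "has_closed_relations (str_cat S n) M"
proof (rule has_closed_relationsI)
  let ?C = "str_cat S n"
  fix m k A R r X f
  assume R: "internal_relation ?C (dim_row M) A R r" and X: "X \<in> Obj ?C"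
    and f: "\<And>v. v < k \<Longrightarrow> f v \<in> hom_set ?C X A" and k: "0 < k" and m: "dim_col M = m"
    and entry: "\<And>i j. i < dim_row M \<Longrightarrow> j < m \<Longrightarrow> M $$ (i, j) < k"
    and left: "\<And>j. j < m \<Longrightarrow> \<exists>u\<in>hom_set ?C X R. \<forall>i<dim_row M. Comp ?C (r i) u = f (M $$ (i, j))"
  have X: "X \<in> str_objs S n" and Robj: "R \<in> str_objs S n"
    using X internal_relationD(1)[OF R] by simp_all
  have full: "row_closed S n (tuples n p)" for p by (rule row_closed_tuples[OF sep n])
  define rs where "rs i = snd (snd (r i))" for i
  define fs where "fs v = snd (snd (f v))" for v
  have r: "r i = (R, A, rs i)" "rs i \<in> tuples (fst A) (fst R)" if "i < dim_row M" for i
    using internal_relationD(3)[OF R that] by (auto simp: str_cat_hom_iff rs_def str_hom_def)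
  have f': "f v = (X, A, fs v)" "str_hom X A (fs v)" if "v < k" for v
    using f[OF that] by (auto simp: str_cat_hom_iff fs_def)
  have "\<exists>us. str_hom X R us \<and> (\<forall>i<dim_row M. \<forall>x<fst A. us ! (rs i ! x) = fs (M $$ (i, j)) ! x)"
    if j: "j < m" for j
  proof -
    obtain us where us: "str_hom X R us"
      and eq: "\<And>i. i < dim_row M \<Longrightarrow> Comp ?C (r i) (X, R, us) = f (M $$ (i, j))"
      using left[OF j] by (auto simp: str_cat_hom_iff)
    have "us ! (rs i ! x) = fs (M $$ (i, j)) ! x" if i: "i < dim_row M" and x: "x < fst A" for i x
    proof -
      have "map ((!) us) (rs i) = fs (M $$ (i, j))"
        using eq[OF i] r(1)[OF i] f'(1)[OF entry[OF i j]] by simp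
      then have "map ((!) us) (rs i) ! x = fs (M $$ (i, j)) ! x" by simp
      then show ?thesis using x r(2)[OF i] by (simp add: tuples_def)
    qed
    then show ?thesis using us by blast
  qed
  then obtain us where us: "\<And>j. j < m \<Longrightarrow> str_hom X R (us j)"
    and us_eq: "\<And>j i x. j < m \<Longrightarrow> i < dim_row M \<Longrightarrow> x < fst A \<Longrightarrow>
      us j ! (rs i ! x) = fs (M $$ (i, j)) ! x"
    by metis
  have "\<exists>i x. i < dim_row M \<and> x < fst A \<and> rs i ! x = z" if "z < fst R" for z
    using jointly_surjective[OF full R that] unfolding rs_def by blast
  \<comment> \<open>Each point \<open>z\<close> of \<open>R\<close> gets one representation, by the
    row \<open>I z\<close> and the point \<open>Y z\<close> of \<open>A\<close>.\<close>
  then obtain I Y where IY: "\<And>z. z < fst R \<Longrightarrow> I z < dim_row M \<and> Y z < fst A \<and> rs (I z) ! Y z = z"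
    by metis
  define ws where "ws = map (\<lambda>z. fs 0 ! Y z) [0..<fst R]"
  have ws: "ws ! (rs i ! x) = fs 0 ! x" if i: "i < dim_row M" and x: "x < fst A" for i x
  proof -
    let ?z = "rs i ! x"
    have z: "?z < fst R" using tuples_nth[OF r(2)[OF i] x] .
    \<comment> \<open>For each left column both sides are the value of \<open>us j\<close> at the
      same point of \<open>R\<close>. Two representations of a point thus give functions of the
      entries that agree along all columns of their two rows, hence also at 0.\<close>
    have "fs (M $$ (I ?z, j)) ! Y ?z = fs (M $$ (i, j)) ! x" if "j < dim_col M" for j
      using us_eq[of j i x] us_eq[of j "I ?z" "Y ?z"] IY[OF z] that m i x by simp
    then have "fs 0 ! Y ?z = fs 0 ! x"
      using rows_not_separable[OF sep[OF M, of "I ?z" i], of "\<lambda>v. fs v ! Y ?z" "\<lambda>v. fs v ! x"]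
        IY[OF z] i by blast
    then show ?thesis using z by (simp add: ws_def)
  qed
  have "str_hom X R ws"
    unfolding str_hom_def
  proof (intro conjI ballI)
    show "ws \<in> tuples (fst R) (fst X)"
      using tuples_nth[OF str_hom_tuples[OF f'(2)[OF k]]] IY by (auto simp: ws_def intro!: tuplesI)
    fix xs assume xs: "xs \<in> set (snd R)"
    then have t: "xs \<in> tuples n (fst R)" using str_objs_tuples[OF Robj] by blast
    have len: "length xs = n" using t by (simp add: tuples_def)
    have comp_nth: "map ((!) zs) xs = map (\<lambda>i. zs ! (xs ! i)) [0..<n]" for zs :: "nat list"
      using len by (auto intro: nth_equalityI)
    have xs_IY: "I (xs ! i) < dim_row M" "Y (xs ! i) < fst A" "rs (I (xs ! i)) ! Y (xs ! i) = xs ! i"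
      if "i < n" for i using IY[OF tuples_nth[OF t that]] by auto
    have Xcl: "row_closed S n (set (snd X))" using X by (auto simp: str_objs_def)
    \<comment> \<open>A tuple of \<open>R\<close> selects the rows \<open>I (xs ! i)\<close>, one
      for each position. The resulting left columns are the images of the tuple under the
      homomorphisms \<open>us j\<close>, and the right column is its image under
      \<open>ws\<close>.\<close>
    have "map (\<lambda>i. fs 0 ! Y (xs ! i)) [0..<n] \<in> set (snd X)"
    proof (rule row_closedD[OF Xcl M, of "\<lambda>i. I (xs ! i)" "\<lambda>i v. fs v ! Y (xs ! i)"])
      fix j assume j: "j < dim_col M"
      have "map (\<lambda>i. fs (M $$ (I (xs ! i), j)) ! Y (xs ! i)) [0..<n] = map ((!) (us j)) xs"
        unfolding comp_nth using us_eq[of j] xs_IY j m by (auto intro!: map_cong) metis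
      then show "map (\<lambda>i. fs (M $$ (I (xs ! i), j)) ! Y (xs ! i)) [0..<n] \<in> set (snd X)"
        using us[of j] xs j m by (simp add: str_hom_def)
    qed (use xs_IY in blast)
    moreover have "map ((!) ws) xs = map (\<lambda>i. fs 0 ! Y (xs ! i)) [0..<n]"
      unfolding comp_nth using tuples_nth[OF t] by (auto simp: ws_def)
    ultimately show "map ((!) ws) xs \<in> set (snd X)" by simp
  qed
  then have "(X, R, ws) \<in> hom_set ?C X R" using X Robj by (simp add: str_cat_hom_iff)
  moreover have "Comp ?C (r i) (X, R, ws) = f 0" if i: "i < dim_row M" for i
  proof -
    have "fs 0 \<in> tuples (fst A) (fst X)" using str_hom_tuples[OF f'(2)[OF k]] .
    then have "map ((!) ws) (rs i) = fs 0"
      using ws[OF i] r(2)[OF i] by (intro nth_equalityI) (auto simp: tuples_def)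
    then show ?thesis using r(1)[OF i] f'(1)[OF k] by simp
  qed
  ultimately show "\<exists>u\<in>hom_set ?C X R. \<forall>i<dim_row M. Comp ?C (r i) u = f 0" by blast
qed

lemma str_cat_not_closed:
  assumes sep: "\<And>M i. M \<in> S \<Longrightarrow> i < dim_row M \<Longrightarrow> \<not> rows_separable M i i"
    and N: "N \<in> matr n m k" and Q: "row_closed S n Q" "Q \<subseteq> tuples n k"
    and cols: "\<And>j. j < m \<Longrightarrow> map (\<lambda>i. N $$ (i, j)) [0..<n] \<in> Q" and zero: "replicate n 0 \<notin> Q"
  shows "\<not> has_closed_relations (str_cat S n) N"
proof
  let ?C = "str_cat S n"
  assume closed: "has_closed_relations ?C N"
  have n: "0 < n" and k: "0 < k" and dims: "dim_row N = n" "dim_col N = m"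
    and entry: "\<And>i j. i < n \<Longrightarrow> j < m \<Longrightarrow> N $$ (i, j) < k"
    using N by (auto simp: matr_def)
  obtain \<Phi> where \<Phi>: "set \<Phi> = Q" using finite_list[OF finite_subset[OF Q(2) finite_tuples]] by blast
  \<comment> \<open>The empty relation on \<open>A\<close> lets every point of \<open>{..<k}\<close>
    be an arrow from \<open>X\<close> to \<open>A\<close>. The single tuple \<open>[0..<n]\<close>
    is sent by a map to the list of its values, so arrows from \<open>X\<close> to \<open>R\<close>
    are exactly the tuples in \<open>Q\<close>.\<close>
  define A R X :: rel_structure where "A = (1, [])" and "R = (n, [[0..<n]])" and "X = (k, \<Phi>)"
  have A: "A \<in> str_objs S n" using row_closed_empty[OF sep n] by (simp add: A_def str_objs_def)
  have R: "R \<in> str_objs S n"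
    using row_closed_singleton[OF sep n, where xs = "[0..<n]"] by (auto simp: R_def str_objs_def tuples_def)
  have X: "X \<in> str_objs S n" using Q \<Phi> by (simp add: X_def str_objs_def)
  define r where "r i = (R, A, [i])" for i :: nat
  define f where "f v = (X, A, [v])" for v :: nat
  have r: "r i \<in> hom_set ?C R A" if "i < n" for i
    using A R that by (auto simp: r_def str_cat_hom_iff str_hom_def tuples_def A_def R_def)
  have f: "f v \<in> hom_set ?C X A" if "v < k" for v
    using A X that by (auto simp: f_def str_cat_hom_iff str_hom_def tuples_def A_def X_def)
  have rel: "internal_relation ?C n A R r"
    unfolding internal_relation_def
  proof (intro conjI allI impI)
    fix Y u v
    assume "u \<in> hom_set ?C Y R" "v \<in> hom_set ?C Y R" and eq: "\<forall>i<n. Comp ?C (r i) u = Comp ?C (r i) v"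
    then obtain us vs where uv: "u = (Y, R, us)" "v = (Y, R, vs)" "us \<in> tuples n (fst Y)" "vs \<in> tuples n (fst Y)"
      by (auto simp: str_cat_hom_iff str_hom_def R_def)
    have "us ! i = vs ! i" if "i < n" for i using eq that by (simp add: uv r_def)
    then have "us = vs" using uv by (auto simp: tuples_def intro: nth_equalityI)
    then show "u = v" by (simp add: uv)
  qed (use A R r in auto)
  have left: "\<exists>u\<in>hom_set ?C X R. \<forall>i<n. Comp ?C (r i) u = f (N $$ (i, j))" if j: "j < m" for j
  proof -
    define us where "us = map (\<lambda>i. N $$ (i, j)) [0..<n]"
    have us: "us \<in> Q" "length us = n" using cols[OF j] by (simp_all add: us_def)
    have "map ((!) us) [0..<n] = us" using us(2) by (auto intro: nth_equalityI)
    then have "str_hom X R us"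
      using us(1) \<Phi> Q(2) by (auto simp: str_hom_def X_def R_def)
    then have "(X, R, us) \<in> hom_set ?C X R" using X R by (simp add: str_cat_hom_iff)
    moreover have "us ! i = N $$ (i, j)" if "i < n" for i using that by (simp add: us_def)
    ultimately show ?thesis
      by (intro bexI[of _ "(X, R, us)"]) (simp_all add: r_def f_def)
  qed
  have "X \<in> Obj ?C" using X by simp
  from has_closed_relationsD[OF closed N rel this f left]
  obtain us where us: "str_hom X R us" and eq: "\<And>i. i < n \<Longrightarrow> Comp ?C (r i) (X, R, us) = f 0"
    by (auto simp: str_cat_hom_iff)
  have "us ! i = 0" if "i < n" for i using eq[OF that] by (simp add: r_def f_def)
  then have "map ((!) us) [0..<n] = replicate n 0" by (auto intro: nth_equalityI)
  then have "replicate n 0 \<in> Q" using us \<Phi> by (simp add: str_hom_def R_def X_def)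
  then show False using zero by blast
qed

section \<open>Transport along injections\<close>

text \<open>Non-inclusion is claimed at all infinite types, while the counterexamples have countable
  ones; they are copied along injections. The unspecified values of \<open>the_inv\<close> outside
  the images never matter, since all objects and arrows of the copy are images.\<close>

definition image_category ::
    "('a \<Rightarrow> 'o) \<Rightarrow> ('b \<Rightarrow> 'm) \<Rightarrow> ('a, 'b) category_data \<Rightarrow> ('o, 'm) category_data" where
  "image_category eo em C = \<lparr>Obj = eo ` Obj C, Arr = em ` Arr C,
     Dom = (\<lambda>f. eo (Dom C (the_inv em f))), Cod = (\<lambda>f. eo (Cod C (the_inv em f))),
     Id = (\<lambda>a. em (Id C (the_inv eo a))), Comp = (\<lambda>g f. em (Comp C (the_inv em g) (the_inv em f)))\<rparr>"

locale injected_category =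
  fixes C :: "('a, 'b) category_data" and eo :: "'a \<Rightarrow> 'o" and em :: "'b \<Rightarrow> 'm"
  assumes inj_eo: "inj eo" and inj_em: "inj em" and cat: "is_category C"
begin

abbreviation "D \<equiv> image_category eo em C"

lemma image_simps [simp]:
  "Obj D = eo ` Obj C"
  "eo a = eo b \<longleftrightarrow> a = b" "em f = em g \<longleftrightarrow> f = g" "the_inv eo (eo a) = a" "the_inv em (em f) = f"
  "Id D (eo a) = em (Id C a)" "Comp D (em g) (em f) = em (Comp C g f)"
  using inj_eo inj_em by (auto simp: image_category_def inj_eq the_inv_f_f)

lemma image_hom [simp]: "em f \<in> hom_set D (eo a) (eo b) \<longleftrightarrow> f \<in> hom_set C a b"
  by (simp add: hom_set_def image_category_def inj_image_mem_iff[OF inj_em])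

lemma image_homE:
  assumes "g \<in> hom_set D x y"
  obtains a b f where "x = eo a" and "y = eo b" and "g = em f" and "f \<in> hom_set C a b"
  using assms by (auto simp: hom_set_def image_category_def)

lemma inv_hom:
  assumes "g \<in> hom_set D (eo a) (eo b)"
  shows "em (the_inv em g) = g" and "the_inv em g \<in> hom_set C a b"
  using assms by (auto elim!: image_homE)

lemma bex_image_hom: "(\<exists>g\<in>hom_set D (eo a) (eo b). P g) \<longleftrightarrow> (\<exists>f\<in>hom_set C a b. P (em f))"
  by (metis image_hom inv_hom)

lemma image_is_category: "is_category D"
  unfolding is_category_def
proof (intro conjI ballI allI impI)
  fix f assume "f \<in> Arr D"
  then show "Dom D f \<in> Obj D" "Cod D f \<in> Obj D"
    using cat by (auto simp: image_category_def is_category_def)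
next
  fix a assume "a \<in> Obj D"
  then show "Id D a \<in> hom_set D a a" using id_in_hom[OF cat] by auto
next
  fix a b c f g
  assume "f \<in> hom_set D a b" and g: "g \<in> hom_set D b c"
  from this(1) show "Comp D g f \<in> hom_set D a c"
    by (rule image_homE) (use g in \<open>auto elim!: image_homE intro: comp_in_hom[OF cat]\<close>)
next
  fix a b f assume "f \<in> hom_set D a b"
  then show "Comp D f (Id D a) = f" "Comp D (Id D b) f = f"
    by (auto elim!: image_homE simp: comp_id[OF cat])
next
  fix a b c d f g h
  assume "f \<in> hom_set D a b" "g \<in> hom_set D b c" "h \<in> hom_set D c d"
  then show "Comp D h (Comp D g f) = Comp D (Comp D h g) f"
    by (auto elim!: image_homE simp: comp_assoc[OF cat])
qed

lemma image_finitely_complete: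
  assumes fc: "finitely_complete C"
  shows "finitely_complete D"
  unfolding finitely_complete_def
proof (intro allI impI)
  fix J :: "(nat, nat) category_data" and F F'
  assume J: "is_category J" and fin: "finite (Arr J)" and func: "is_functor J D F F'"
  define G where "G i = the_inv eo (F i)" for i
  define G' where "G' u = the_inv em (F' u)" for u
  have F: "F i = eo (G i)" "G i \<in> Obj C" if "i \<in> Obj J" for i
    using func that by (auto simp: is_functor_def G_def)
  have F': "F' u = em (G' u)" "G' u \<in> hom_set C (G i) (G j)" if u: "u \<in> hom_set J i j" for u i j
  proof -
    have "F' u \<in> hom_set D (F i) (F j)" using func u unfolding is_functor_def by blast
    then have "F' u \<in> hom_set D (eo (G i)) (eo (G j))" using F hom_objs[OF J u] by simp
    then show "F' u = em (G' u)" "G' u \<in> hom_set C (G i) (G j)"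
      using inv_hom unfolding G'_def by fastforce+
  qed
  have "is_functor J C G G'"
    unfolding is_functor_def
  proof (intro conjI ballI allI impI)
    fix i assume i: "i \<in> Obj J"
    have "F' (Id J i) = Id D (F i)" using func i by (simp add: is_functor_def)
    then show "G' (Id J i) = Id C (G i)"
      using F(1)[OF i] F'(1)[OF id_in_hom[OF J i]] by simp
  next
    fix i j l u v assume u: "u \<in> hom_set J i j" and v: "v \<in> hom_set J j l"
    have "F' (Comp J v u) = Comp D (F' v) (F' u)"
      using func u v unfolding is_functor_def by blast
    then show "G' (Comp J v u) = Comp C (G' v) (G' u)"
      using F'(1)[OF u] F'(1)[OF v] F'(1)[OF comp_in_hom[OF J u v]] by simp
  qed (use F F' in auto)
  then obtain L p where lim: "is_limit J C G G' L p"
    using fc J fin unfolding finitely_complete_def by blast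
  \<comment> \<open>A family of legs is a total function, so being an image can be demanded only at
    the objects of \<open>J\<close>; elsewhere \<open>q\<close> is arbitrary.\<close>
  have cone_iff: "is_cone J D F F' (eo X) q \<longleftrightarrow>
      is_cone J C G G' X (\<lambda>i. the_inv em (q i)) \<and> (\<forall>i\<in>Obj J. em (the_inv em (q i)) = q i)" for X q
  proof
    assume c: "is_cone J D F F' (eo X) q"
    have q: "em (the_inv em (q i)) = q i" "the_inv em (q i) \<in> hom_set C X (G i)" if "i \<in> Obj J" for i
    proof -
      have "q i \<in> hom_set D (eo X) (F i)" using c that unfolding is_cone_def by blast
      then have "q i \<in> hom_set D (eo X) (eo (G i))" unfolding F(1)[OF that] .
      then show "em (the_inv em (q i)) = q i" "the_inv em (q i) \<in> hom_set C X (G i)" by (rule inv_hom)+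
    qed
    have "Comp C (G' u) (the_inv em (q i)) = the_inv em (q j)" if u: "u \<in> hom_set J i j" for i j u
    proof -
      have "Comp D (F' u) (q i) = q j" using c u unfolding is_cone_def by blast
      then have "Comp D (em (G' u)) (em (the_inv em (q i))) = em (the_inv em (q j))"
        using q(1) hom_objs[OF J u] F'(1)[OF u] by simp
      then show ?thesis by simp
    qed
    then show "is_cone J C G G' X (\<lambda>i. the_inv em (q i)) \<and> (\<forall>i\<in>Obj J. em (the_inv em (q i)) = q i)"
      using c q by (auto simp: is_cone_def)
  next
    assume c: "is_cone J C G G' X (\<lambda>i. the_inv em (q i)) \<and> (\<forall>i\<in>Obj J. em (the_inv em (q i)) = q i)"
    have "q i \<in> hom_set D (eo X) (F i)" if "i \<in> Obj J" for i
    proof -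
      have "the_inv em (q i) \<in> hom_set C X (G i)" using c that by (simp add: is_cone_def)
      then have "em (the_inv em (q i)) \<in> hom_set D (eo X) (eo (G i))" unfolding image_hom .
      moreover have "em (the_inv em (q i)) = q i" using c that by blast
      ultimately show ?thesis using F(1)[OF that] by metis
    qed
    moreover have "Comp D (F' u) (q i) = q j" if u: "u \<in> hom_set J i j" for i j u
    proof -
      have "Comp C (G' u) (the_inv em (q i)) = the_inv em (q j)" using c u unfolding is_cone_def by blast
      then have "Comp D (em (G' u)) (em (the_inv em (q i))) = em (the_inv em (q j))" by simp
      then show ?thesis using c hom_objs[OF J u] F'(1)[OF u] by simp
    qed
    ultimately show "is_cone J D F F' (eo X) q" using c by (auto simp: is_cone_def)
  qed
  have "is_limit J D F F' (eo L) (\<lambda>i. em (p i))"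
    unfolding is_limit_def
  proof (intro conjI allI impI)
    show "is_cone J D F F' (eo L) (\<lambda>i. em (p i))"
      using lim by (simp add: cone_iff is_limit_def)
    fix X' q assume c: "is_cone J D F F' X' q"
    then obtain X where X: "X' = eo X" by (auto simp: is_cone_def)
    have q: "is_cone J C G G' X (\<lambda>i. the_inv em (q i))" "\<forall>i\<in>Obj J. em (the_inv em (q i)) = q i"
      using c cone_iff X by simp_all
    have iff: "(\<forall>i\<in>Obj J. Comp D (em (p i)) (em h) = q i) \<longleftrightarrow>
        (\<forall>i\<in>Obj J. Comp C (p i) h = the_inv em (q i))" for h
    proof -
      have "Comp D (em (p i)) (em h) = q i \<longleftrightarrow> Comp C (p i) h = the_inv em (q i)" if "i \<in> Obj J" for i
        using q(2) that by (metis image_simps(3,7))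
      then show ?thesis by blast
    qed
    have "\<exists>!h. h \<in> hom_set C X L \<and> (\<forall>i\<in>Obj J. Comp C (p i) h = the_inv em (q i))"
      using lim q(1) unfolding is_limit_def by blast
    then obtain h where h: "h \<in> hom_set C X L" "\<forall>i\<in>Obj J. Comp C (p i) h = the_inv em (q i)"
      and uniq: "\<And>h'. h' \<in> hom_set C X L \<Longrightarrow> \<forall>i\<in>Obj J. Comp C (p i) h' = the_inv em (q i) \<Longrightarrow> h' = h"
      by blast
    show "\<exists>!h. h \<in> hom_set D X' (eo L) \<and> (\<forall>i\<in>Obj J. Comp D (em (p i)) h = q i)"
    proof (rule ex1I[of _ "em h"])
      show "em h \<in> hom_set D X' (eo L) \<and> (\<forall>i\<in>Obj J. Comp D (em (p i)) (em h) = q i)"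
        unfolding iff X image_hom using h by blast
      fix k assume k: "k \<in> hom_set D X' (eo L) \<and> (\<forall>i\<in>Obj J. Comp D (em (p i)) k = q i)"
      then have k': "em (the_inv em k) = k" "the_inv em k \<in> hom_set C X L" using inv_hom X by blast+
      then have "\<forall>i\<in>Obj J. Comp C (p i) (the_inv em k) = the_inv em (q i)" using k iff by metis
      then show "k = em h" using uniq[OF k'(2)] k'(1) by metis
    qed
  qed
  then show "\<exists>L p. is_limit J D F F' L p" by blast
qed

lemma image_internal_relation:
  assumes "\<And>i. i < n \<Longrightarrow> r' i = em (r i)"
  shows "internal_relation D n (eo A) (eo R) r' \<longleftrightarrow> internal_relation C n A R r"
proof
  assume rel: "internal_relation D n (eo A) (eo R) r'"
  show "internal_relation C n A R r"
    unfolding internal_relation_def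
  proof (intro conjI allI impI)
    show "R \<in> Obj C" "A \<in> Obj C" using internal_relationD(1,2)[OF rel] by auto
    show "r i \<in> hom_set C R A" if "i < n" for i
      using internal_relationD(3)[OF rel that] assms[OF that] by simp
    fix X u v assume uv: "u \<in> hom_set C X R" "v \<in> hom_set C X R" "\<forall>i<n. Comp C (r i) u = Comp C (r i) v"
    have "em u = em v"
      by (rule internal_relationD(4)[OF rel, of _ "eo X"]) (use uv assms in auto)
    then show "u = v" by simp
  qed
next
  assume rel: "internal_relation C n A R r"
  show "internal_relation D n (eo A) (eo R) r'"
    unfolding internal_relation_def
  proof (intro conjI allI impI)
    show "eo R \<in> Obj D" "eo A \<in> Obj D" using internal_relationD(1,2)[OF rel] by auto
    show "r' i \<in> hom_set D (eo R) (eo A)" if "i < n" for i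
      using internal_relationD(3)[OF rel that] assms[OF that] by simp
    fix X' u v
    assume u: "u \<in> hom_set D X' (eo R)" and v: "v \<in> hom_set D X' (eo R)"
      and eq: "\<forall>i<n. Comp D (r' i) u = Comp D (r' i) v"
    obtain X where X: "X' = eo X" using u by (rule image_homE)
    note u' = inv_hom[OF u[unfolded X]] and v' = inv_hom[OF v[unfolded X]]
    have "the_inv em u = the_inv em v"
    proof (rule internal_relationD(4)[OF rel u'(2) v'(2)])
      fix i assume i: "i < n"
      have "Comp D (em (r i)) (em (the_inv em u)) = Comp D (em (r i)) (em (the_inv em v))"
        using eq assms i u'(1) v'(1) by simp
      then show "Comp C (r i) (the_inv em u) = Comp C (r i) (the_inv em v)" by simp
    qed
    then show "u = v" using u'(1) v'(1) by metis
  qed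
qed

lemma image_has_closed_relations: "has_closed_relations D N \<longleftrightarrow> has_closed_relations C N"
proof
  assume D: "has_closed_relations D N"
  show "has_closed_relations C N"
  proof (rule has_closed_relationsI)
    fix m k A R r X f
    assume N: "N \<in> matr (dim_row N) m k" and rel: "internal_relation C (dim_row N) A R r"
      and X: "X \<in> Obj C" and f: "\<And>v. v < k \<Longrightarrow> f v \<in> hom_set C X A"
      and left: "\<And>j. j < m \<Longrightarrow> \<exists>u\<in>hom_set C X R. \<forall>i<dim_row N. Comp C (r i) u = f (N $$ (i, j))"
    have "\<exists>u\<in>hom_set D (eo X) (eo R). \<forall>i<dim_row N. Comp D (em (r i)) u = em (f 0)"
    proof (rule has_closed_relationsD[OF D N, of "eo A"])
      show "internal_relation D (dim_row N) (eo A) (eo R) (\<lambda>i. em (r i))"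
        using rel image_internal_relation by simp
      show "\<exists>u\<in>hom_set D (eo X) (eo R). \<forall>i<dim_row N. Comp D (em (r i)) u = em (f (N $$ (i, j)))"
        if "j < m" for j using left[OF that] by (simp add: bex_image_hom)
    qed (use X f in auto)
    then show "\<exists>u\<in>hom_set C X R. \<forall>i<dim_row N. Comp C (r i) u = f 0" by (simp add: bex_image_hom)
  qed
next
  assume C: "has_closed_relations C N"
  show "has_closed_relations D N"
  proof (rule has_closed_relationsI)
    fix m k A' R' r' X' f'
    assume N: "N \<in> matr (dim_row N) m k" and rel: "internal_relation D (dim_row N) A' R' r'"
      and X': "X' \<in> Obj D" and f': "\<And>v. v < k \<Longrightarrow> f' v \<in> hom_set D X' A'"
      and k: "0 < k" and entry: "\<And>i j. i < dim_row N \<Longrightarrow> j < m \<Longrightarrow> N $$ (i, j) < k"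
      and left: "\<And>j. j < m \<Longrightarrow> \<exists>u\<in>hom_set D X' R'. \<forall>i<dim_row N. Comp D (r' i) u = f' (N $$ (i, j))"
    obtain A R X where objs: "A' = eo A" "R' = eo R" "X' = eo X"
      using internal_relationD(1,2)[OF rel] X' by auto
    define r f where "r i = the_inv em (r' i)" and "f v = the_inv em (f' v)" for i v
    have r: "r' i = em (r i)" if "i < dim_row N" for i
      using inv_hom(1) internal_relationD(3)[OF rel that] by (simp add: objs r_def)
    have f: "f' v = em (f v)" if "v < k" for v
      using inv_hom(1) f'[OF that] by (simp add: objs f_def)
    have "\<exists>u\<in>hom_set C X R. \<forall>i<dim_row N. Comp C (r i) u = f 0"
    proof (rule has_closed_relationsD[OF C N, of A])
      show "internal_relation C (dim_row N) A R r"
        using rel image_internal_relation[OF r] by (simp add: objs)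
      show "X \<in> Obj C" using X' by (auto simp: objs)
      show "f v \<in> hom_set C X A" if "v < k" for v
        using f'[OF that] f[OF that] by (simp add: objs)
      show "\<exists>u\<in>hom_set C X R. \<forall>i<dim_row N. Comp C (r i) u = f (N $$ (i, j))" if j: "j < m" for j
        using left[OF j] r f entry[OF _ j] by (simp add: objs bex_image_hom)
    qed
    then show "\<exists>u\<in>hom_set D X' R'. \<forall>i<dim_row N. Comp D (r' i) u = f' 0"
      using r f[OF k] by (simp add: objs bex_image_hom)
  qed
qed

end

text \<open>Both injections factor through the naturals: a countable type embeds into them, and they
  embed into any infinite type.\<close>

lemma separating_category:
  fixes C :: "('a :: countable, 'b :: countable) category_data"
  assumes "infinite (UNIV :: 'o set)" and "infinite (UNIV :: 'm set)"
    and C: "C \<in> mclex S" and N: "N \<in> U" "\<not> has_closed_relations C N"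
  shows "\<not> (mclex S :: ('o, 'm) category_data set) \<subseteq> mclex U"
proof -
  obtain eo' :: "nat \<Rightarrow> 'o" where "inj eo'" using infinite_countable_subset[OF assms(1)] by blast
  then have "inj (eo' \<circ> (to_nat :: 'a \<Rightarrow> nat))" by (rule inj_compose) simp
  moreover obtain em' :: "nat \<Rightarrow> 'm" where "inj em'" using infinite_countable_subset[OF assms(2)] by blast
  then have "inj (em' \<circ> (to_nat :: 'b \<Rightarrow> nat))" by (rule inj_compose) simp
  ultimately interpret injected_category C "eo' \<circ> to_nat" "em' \<circ> to_nat"
    using C by unfold_locales (auto simp: mclex_def)
  have "D \<in> mclex S"
    using C image_is_category image_finitely_complete image_has_closed_relations by (simp add: mclex_def)
  moreover have "D \<notin> mclex U" using N image_has_closed_relations by (auto simp: mclex_def)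
  ultimately show ?thesis by blast
qed

section \<open>The two-element chain\<close>

text \<open>Being a preorder, the chain has closed relations for every nonempty matrix, yet it has a
  proper subobject of 1. This is the counterexample for the negative decision in Step 0.\<close>

definition chain_cat :: "(nat, nat \<times> nat) category_data" where
  "chain_cat = \<lparr>Obj = {0, 1}, Arr = {(a, b). a \<le> b \<and> b \<le> 1}, Dom = fst, Cod = snd,
     Id = (\<lambda>a. (a, a)), Comp = (\<lambda>g f. (fst f, snd g))\<rparr>"

lemma chain_hom: "f \<in> hom_set chain_cat a b \<longleftrightarrow> f = (a, b) \<and> a \<le> b \<and> b \<le> 1"
  by (auto simp: hom_set_def chain_cat_def)

lemma chain_obj: "Obj chain_cat = {0, 1}"
  by (simp add: chain_cat_def)

lemma chain_is_category: "is_category chain_cat"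
  unfolding is_category_def chain_hom by (auto simp: chain_cat_def)

lemma chain_finitely_complete: "finitely_complete chain_cat"
  unfolding finitely_complete_def
proof (intro allI impI)
  fix J :: "(nat, nat) category_data" and F F'
  assume J: "is_category J" and func: "is_functor J chain_cat F F'"
  have F: "F i \<le> 1" if "i \<in> Obj J" for i
    using func that by (auto simp: is_functor_def chain_cat_def)
  have F': "F' u = (F i, F j)" if "u \<in> hom_set J i j" for i j u
    using func that unfolding is_functor_def chain_hom by blast
  \<comment> \<open>The infimum of the objects of the diagram, which is 1 for the empty
    diagram.\<close>
  define L where "L = (if \<exists>i\<in>Obj J. F i = 0 then 0 else 1 :: nat)"
  have L: "L \<le> F i" if "i \<in> Obj J" for i
    using that F[OF that] by (auto simp: L_def)
  have "is_limit J chain_cat F F' L (\<lambda>i. (L, F i))"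
    unfolding is_limit_def is_cone_def chain_hom
  proof (intro conjI ballI allI impI)
    show "L \<in> Obj chain_cat" by (simp add: L_def chain_cat_def)
    fix i j u assume "u \<in> hom_set J i j"
    then show "Comp chain_cat (F' u) (L, F i) = (L, F j)" using F' by (simp add: chain_cat_def)
  next
    fix X q
    assume c: "X \<in> Obj chain_cat \<and> (\<forall>i\<in>Obj J. q i = (X, F i) \<and> X \<le> F i \<and> F i \<le> 1) \<and>
      (\<forall>i j u. u \<in> hom_set J i j \<longrightarrow> Comp chain_cat (F' u) (q i) = q j)"
    then have "X \<le> L" "L \<le> 1" by (auto simp: L_def chain_cat_def)
    then show "\<exists>!h. (h = (X, L) \<and> X \<le> L \<and> L \<le> 1) \<and> (\<forall>i\<in>Obj J. Comp chain_cat (L, F i) h = q i)"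
      using c by (auto simp: chain_cat_def)
  qed (use L F in auto)
  then show "\<exists>L p. is_limit J chain_cat F F' L p" by blast
qed

text \<open>The relation consists of \<open>n\<close> copies of the arrow from 0 to 1. Closedness
  for a matrix without columns would give an arrow back from 1 to 0.\<close>

lemma chain_not_closed:
  assumes N: "N \<in> matr n m k" and e: "empty_matrix N"
  shows "\<not> has_closed_relations chain_cat N"
proof
  assume cl: "has_closed_relations chain_cat N"
  have m: "m = 0" using N e by (auto simp: matr_def empty_matrix_def)
  have "0 < n" using N by (simp add: matr_def)
  then have "internal_relation chain_cat n 1 0 (\<lambda>_. (0, 1))"
    unfolding internal_relation_def chain_hom by (auto simp: chain_cat_def)
  then have "\<exists>u\<in>hom_set chain_cat 1 0. \<forall>i<n. Comp chain_cat (0, 1) u = (1, 1)"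
    by (rule has_closed_relationsD[OF cl N, where X = 1 and f = "\<lambda>_. (1, 1)"])
      (use m in \<open>simp_all add: chain_hom chain_obj\<close>)
  then obtain u where "u \<in> hom_set chain_cat 1 0" by blast
  then show False unfolding chain_hom by simp
qed

section \<open>Expansions\<close>

definition vecs :: "nat \<Rightarrow> nat \<Rightarrow> nat vec set" where
  "vecs n k = {v \<in> carrier_vec n. \<forall>i<n. v $ i < k}"

definition expansion :: "nat mat set \<Rightarrow> nat \<Rightarrow> nat mat \<Rightarrow> nat mat \<Rightarrow> bool" where
  "expansion S k N N' \<longleftrightarrow> (\<exists>b. expansion_column S k N b \<and> N' = adjoin_column N b)"

lemma finite_vecs: "finite (vecs n k)"
proof (rule finite_subset)
  show "vecs n k \<subseteq> vec_of_list ` tuples n k"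
  proof
    fix v assume v: "v \<in> vecs n k"
    have "list_of_vec v \<in> tuples n k"
      using v by (auto simp: vecs_def list_of_vec_index intro!: tuplesI)
    then show "v \<in> vec_of_list ` tuples n k"
      using vec_list[of v] by (metis imageI)
  qed
qed (simp add: finite_tuples)

lemma expansion_column_vecs: "expansion_column S k N b \<Longrightarrow> b \<in> vecs (dim_row N) k"
  unfolding expansion_column_def
  by (auto simp: vecs_def matr_def right_column_def rowwise_interpretation_def Pi_iff)

lemma cols_adjoin_column:
  assumes "expansion_column S k N b"
  shows "cols (adjoin_column N b) = cols N @ [b]" and "dim_row (adjoin_column N b) = dim_row N"
proof -
  have "set (cols N @ [b]) \<subseteq> carrier_vec (dim_row N)"
    using expansion_column_vecs[OF assms] cols_dim[of N] by (auto simp: vecs_def)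
  then show "cols (adjoin_column N b) = cols N @ [b]" "dim_row (adjoin_column N b) = dim_row N"
    unfolding adjoin_column_def by simp_all
qed

lemma cols_eq: "set (cols N) = (\<lambda>j. col N j) ` {..<dim_col N}"
  by (auto simp: cols_def)

lemma cols_matr_vecs: "N \<in> matr n m k \<Longrightarrow> set (cols N) \<subseteq> vecs n k"
  by (auto simp: cols_eq matr_def vecs_def)

lemma expansions_cols:
  assumes "(expansion S k)\<^sup>*\<^sup>* N N'" and N: "N \<in> matr n m k"
  shows "dim_row N' = n \<and> set (cols N) \<subseteq> set (cols N') \<and> set (cols N') \<subseteq> vecs n k"
  using assms(1)
proof induction
  case base
  then show ?case using cols_matr_vecs[OF N] N by (auto simp: matr_def)
next
  case (step N1 N2)
  then obtain b where b: "expansion_column S k N1 b" "N2 = adjoin_column N1 b"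
    unfolding expansion_def by blast
  show ?case using step.IH expansion_column_vecs[OF b(1)] cols_adjoin_column[OF b(1)] b(2) by auto
qed

text \<open>Composing \<open>f\<close> with the row-wise interpretation \<open>h\<close> that
  produced a column yields a row-wise interpretation in arrows, to which
  \<open>rowwise_closed\<close> applies; the induction hypothesis covers its left columns.\<close>

lemma expansions_sound:
  assumes C: "C \<in> mclex S" and N: "N \<in> matr n m k" and exp: "(expansion S k)\<^sup>*\<^sup>* N N'"
    and R: "internal_relation C n A R r" and X: "X \<in> Obj C"
    and f: "\<And>v. v < k \<Longrightarrow> f v \<in> hom_set C X A"
    and N_cols: "\<And>c. c \<in> set (cols N) \<Longrightarrow> \<exists>u\<in>hom_set C X R. \<forall>i<n. Comp C (r i) u = f (c $ i)"
    and c: "c \<in> set (cols N')"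
  shows "\<exists>u\<in>hom_set C X R. \<forall>i<n. Comp C (r i) u = f (c $ i)"
  using exp c
proof (induction arbitrary: c)
  case base
  then show ?case by (rule N_cols)
next
  case (step N1 N2)
  then obtain b where b: "expansion_column S k N1 b" "N2 = adjoin_column N1 b"
    unfolding expansion_def by blast
  have n: "dim_row N1 = n" using expansions_cols[OF step.hyps(1) N] by blast
  have "\<exists>u\<in>hom_set C X R. \<forall>i<n. Comp C (r i) u = f (b $ i)"
  proof -
    obtain n' m' k' M M' h where M: "M \<in> S" "M \<in> matr n' m' k'" and M': "M' \<in> matr n m' k'"
      and rows: "set (rows M') \<subseteq> set (rows M)"
      and h: "rowwise_interpretation k' M' (\<lambda>_. {..<k}) h"
      and left: "left_columns M' h \<subseteq> set (cols N1)" and b_eq: "b = right_column M' h"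
      using b(1) unfolding expansion_column_def n by blast
    have d: "dim_row M = n'" "dim_col M = m'" "dim_row M' = n" "dim_col M' = m'" "0 < k'"
      using M M' by (auto simp: matr_def)
    have h_lt: "h i v < k" if "i < n" "v < k'" for i v
      using h that d by (auto simp: rowwise_interpretation_def Pi_iff)
    have "\<exists>s<n'. row M' i = row M s" if "i < n" for i
    proof -
      have "row M' i \<in> set (rows M')" using that d by (auto simp: rows_def)
      then have "row M' i \<in> set (rows M)" using rows by blast
      then show ?thesis using d by (auto simp: rows_def)
    qed
    then obtain \<sigma> where \<sigma>: "\<And>i. i < n \<Longrightarrow> \<sigma> i < n'" "\<And>i. i < n \<Longrightarrow> row M' i = row M (\<sigma> i)"
      by metis
    have entry: "M $$ (\<sigma> i, j) = M' $$ (i, j)" if "i < n" "j < m'" for i j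
      using arg_cong[OF \<sigma>(2)[OF that(1)], of "\<lambda>v. v $ j"] \<sigma>(1)[OF that(1)] that d by simp
    have "\<exists>u\<in>hom_set C X R. \<forall>i<n. Comp C (r i) u = f (h i 0)"
    proof (rule rowwise_closed[where M = M and \<sigma> = \<sigma> and g = "\<lambda>i v. f (h i v)"])
      show "is_category C" "finitely_complete C" "has_closed_relations C M"
        using C M(1) by (auto simp: mclex_def)
      fix j assume j: "j < m'"
      have "vec n (\<lambda>i. h i (M' $$ (i, j))) \<in> set (cols N1)"
        using left j d by (auto simp: left_columns_eq)
      from step.IH[OF this] obtain u where u: "u \<in> hom_set C X R"
        and u_eq: "\<And>i. i < n \<Longrightarrow> Comp C (r i) u = f (vec n (\<lambda>i. h i (M' $$ (i, j))) $ i)" by blast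
      have "Comp C (r i) u = f (h i (M $$ (\<sigma> i, j)))" if "i < n" for i
        using u_eq[OF that] entry[OF that j] that by simp
      then show "\<exists>u\<in>hom_set C X R. \<forall>i<n. Comp C (r i) u = f (h i (M $$ (\<sigma> i, j)))"
        using u by blast
    qed (use M(2) R X \<sigma>(1) f h_lt in auto)
    then show ?thesis using d by (simp add: b_eq right_column_def)
  qed
  then show ?case using step.prems step.IH cols_adjoin_column(1)[OF b(1)] b(2) by auto
qed

text \<open>Some sequence of expansions for some admissible \<open>k\<close> is enough: soundness of
  a positive answer depends neither on the order of expansions nor on their maximality.\<close>

definition accepted :: "nat mat set \<Rightarrow> nat mat \<Rightarrow> bool" where
  "accepted S N \<longleftrightarrow> (\<exists>n m k N'. N \<in> matr n m k \<and> (expansion S k)\<^sup>*\<^sup>* N N' \<and> 0\<^sub>v n \<in> set (cols N'))"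

lemma accepted_closed:
  assumes C: "C \<in> mclex S" and "accepted S N"
  shows "has_closed_relations C N"
proof (rule has_closed_relationsI)
  obtain n m k N' where N: "N \<in> matr n m k" and exp: "(expansion S k)\<^sup>*\<^sup>* N N'" and z: "0\<^sub>v n \<in> set (cols N')"
    using assms(2) unfolding accepted_def by blast
  fix m' k' A R r X f
  assume R: "internal_relation C (dim_row N) A R r" and X: "X \<in> Obj C"
    and f: "\<And>v. v < k' \<Longrightarrow> f v \<in> hom_set C X A" and k': "0 < k'" and m': "dim_col N = m'"
    and entry: "\<And>i j. i < dim_row N \<Longrightarrow> j < m' \<Longrightarrow> N $$ (i, j) < k'"
    and left: "\<And>j. j < m' \<Longrightarrow> \<exists>u\<in>hom_set C X R. \<forall>i<dim_row N. Comp C (r i) u = f (N $$ (i, j))"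
  have d: "dim_row N = n" "dim_col N = m" using N by (auto simp: matr_def)
  \<comment> \<open>The bound \<open>k\<close> used for expanding may exceed the bound
    \<open>k'\<close> of the interpretation, so \<open>f\<close> is continued by the value
    \<open>f 0\<close>.\<close>
  define h where "h v = (if v < k' then f v else f 0)" for v
  have "\<exists>u\<in>hom_set C X R. \<forall>i<n. Comp C (r i) u = h (0\<^sub>v n $ i)"
  proof (rule expansions_sound[OF C N exp R[unfolded d] X _ _ z])
    show "h v \<in> hom_set C X A" for v using f k' by (simp add: h_def)
    fix c assume "c \<in> set (cols N)"
    then obtain j where j: "j < m'" "c = col N j" using m' by (auto simp: cols_eq)
    have "h (c $ i) = f (N $$ (i, j))" if "i < n" for i
      using entry[of i j] j that d m' by (simp add: h_def)
    then show "\<exists>u\<in>hom_set C X R. \<forall>i<n. Comp C (r i) u = h (c $ i)" using left[OF j(1)] d by simp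
  qed
  then show "\<exists>u\<in>hom_set C X R. \<forall>i<dim_row N. Comp C (r i) u = f 0"
    using k' d by (simp add: h_def)
qed

text \<open>A violation of row-closedness would be a column that can still be adjoined. The two
  notions differ in that \<open>row_closed\<close> admits unbounded functions, whereas expansions
  take values in \<open>{..<k}\<close>.\<close>

lemma row_closed_complete_expansion:
  assumes S: "matrix_set S"
    and sep: "\<And>M i. M \<in> S \<Longrightarrow> i < dim_row M \<Longrightarrow> \<not> rows_separable M i i"
    and N: "dim_row N = n" "set (cols N) \<subseteq> vecs n k" and pos: "0 < n" "0 < k"
    and complete: "\<nexists>b. expansion_column S k N b"
  shows "row_closed S n (list_of_vec ` set (cols N))"
proof (rule row_closedI)
  let ?Q = "list_of_vec ` set (cols N)"
  fix M \<sigma> and g :: "nat \<Rightarrow> nat \<Rightarrow> nat"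
  assume M: "M \<in> S" and \<sigma>: "\<And>i. i < n \<Longrightarrow> \<sigma> i < dim_row M"
    and left: "\<And>j. j < dim_col M \<Longrightarrow> map (\<lambda>i. g i (M $$ (\<sigma> i, j))) [0..<n] \<in> ?Q"
  obtain n' m' k' where M_matr: "M \<in> matr n' m' k'" using S M by (auto simp: matrix_set_def)
  then have d: "dim_row M = n'" "dim_col M = m'" "0 < k'"
    and entry: "\<And>i j. i < n' \<Longrightarrow> j < m' \<Longrightarrow> M $$ (i, j) < k'" by (auto simp: matr_def)
  define M' where "M' = mat n m' (\<lambda>(i, j). M $$ (\<sigma> i, j))"
  \<comment> \<open>Values of \<open>g\<close> at numbers absent from the selected row may be too
    large and are replaced by 0. The columns are unaffected, including the right one, because 0
    occurs in each row.\<close>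
  define h where "h i v = (if \<exists>j<m'. M $$ (\<sigma> i, j) = v then g i v else 0)" for i v
  have vec_in: "vec n (\<lambda>i. w i) \<in> set (cols N) \<longleftrightarrow> map w [0..<n] \<in> ?Q" for w
  proof
    assume "vec n (\<lambda>i. w i) \<in> set (cols N)"
    moreover have "list_of_vec (vec n (\<lambda>i. w i)) = map w [0..<n]"
      by (intro nth_equalityI) (auto simp: list_of_vec_index)
    ultimately show "map w [0..<n] \<in> ?Q" by (metis imageI)
  next
    assume "map w [0..<n] \<in> ?Q"
    then obtain c where c: "c \<in> set (cols N)" "list_of_vec c = map w [0..<n]" by force
    have "vec n (\<lambda>i. w i) = c"
    proof (rule eq_vecI)
      show dim: "dim_vec (vec n (\<lambda>i. w i)) = dim_vec c" using c N by (auto simp: vecs_def)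
      fix i assume "i < dim_vec c"
      then show "vec n (\<lambda>i. w i) $ i = c $ i" using dim list_of_vec_index[of c i] c(2) by simp
    qed
    then show "vec n (\<lambda>i. w i) \<in> set (cols N)" using c by simp
  qed
  have left': "vec n (\<lambda>i. g i (M $$ (\<sigma> i, j))) \<in> set (cols N)" if "j < m'" for j
    unfolding vec_in using left that d by blast
  have "h i v < k" if i: "i < n" for i v
  proof (cases "\<exists>j<m'. M $$ (\<sigma> i, j) = v")
    case True
    then obtain j where j: "j < m'" "M $$ (\<sigma> i, j) = v" by blast
    have "vec n (\<lambda>i. g i (M $$ (\<sigma> i, j))) \<in> vecs n k" using left'[OF j(1)] N(2) by blast
    then have "g i (M $$ (\<sigma> i, j)) < k" using i by (auto simp: vecs_def)
    then show ?thesis using j pos by (simp add: h_def)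
  qed (use pos in \<open>auto simp: h_def\<close>)
  then have interp: "rowwise_interpretation k' M' (\<lambda>_. {..<k}) h"
    by (simp add: rowwise_interpretation_def M'_def)
  have M'_matr: "M' \<in> matr n m' k'"
    using entry \<sigma> pos d by (auto simp: matr_def M'_def)
  have rows: "set (rows M') \<subseteq> set (rows M)"
  proof
    fix x assume "x \<in> set (rows M')"
    then obtain i where i: "i < n" "x = row M' i" by (auto simp: rows_def M'_def)
    have "row M' i = row M (\<sigma> i)" using i \<sigma> d by (intro eq_vecI) (auto simp: M'_def)
    then show "x \<in> set (rows M)" using i \<sigma> d by (auto simp: rows_def)
  qed
  have "vec n (\<lambda>i. h i (M' $$ (i, j))) = vec n (\<lambda>i. g i (M $$ (\<sigma> i, j)))" if "j < m'" for j
    using that by (intro eq_vecI) (auto simp: h_def M'_def)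
  then have "left_columns M' h \<subseteq> set (cols N)"
    using left' by (auto simp: left_columns_eq M'_def)
  moreover have "right_column M' h = vec n (\<lambda>i. g i 0)"
  proof -
    have "h i 0 = g i 0" if "i < n" for i
      by (rule zero_in_row[OF sep[OF M \<sigma>[OF that]]]) (use d in \<open>auto simp: h_def\<close>)
    then show ?thesis by (intro eq_vecI) (auto simp: right_column_def M'_def)
  qed
  ultimately have "expansion_column S k N (vec n (\<lambda>i. g i 0))"
    if "vec n (\<lambda>i. g i 0) \<notin> set (cols N)"
    unfolding expansion_column_def using that M M_matr M'_matr rows interp N(1)
    by (intro exI[of _ n'] exI[of _ m'] exI[of _ k'] exI[of _ M] exI[of _ M'] exI[of _ h]) simp
  then have "vec n (\<lambda>i. g i 0) \<in> set (cols N)" using complete by blast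
  then show "map (\<lambda>i. g i 0) [0..<n] \<in> ?Q" unfolding vec_in .
qed

lemma rejected_not_closed:
  assumes S: "matrix_set S"
    and sep: "\<And>M i. M \<in> S \<Longrightarrow> i < dim_row M \<Longrightarrow> \<not> rows_separable M i i"
    and N: "N \<in> matr n m k" and exp: "(expansion S k)\<^sup>*\<^sup>* N N'"
    and complete: "\<nexists>b. expansion_column S k N' b" and zero: "0\<^sub>v n \<notin> set (cols N')"
  shows "\<not> has_closed_relations (str_cat S n) N"
proof (rule str_cat_not_closed[OF sep N])
  let ?Q = "list_of_vec ` set (cols N')"
  have pos: "0 < n" "0 < k" and d: "dim_row N = n" "dim_col N = m" using N by (auto simp: matr_def)
  note N' = expansions_cols[OF exp N]
  show "row_closed S n ?Q"
    using row_closed_complete_expansion[OF S sep _ _ pos complete] N' by blast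
  have vecs: "c \<in> vecs n k" if "c \<in> set (cols N')" for c using N' that by blast
  show "?Q \<subseteq> tuples n k"
    using vecs by (fastforce simp: vecs_def list_of_vec_index intro!: tuplesI)
  show "map (\<lambda>i. N $$ (i, j)) [0..<n] \<in> ?Q" if "j < m" for j
  proof -
    have "col N j \<in> set (cols N')" using N' that d by (auto simp: cols_eq)
    moreover have "list_of_vec (col N j) = map (\<lambda>i. N $$ (i, j)) [0..<n]"
      using that d by (intro nth_equalityI) (auto simp: list_of_vec_index)
    ultimately show ?thesis by (metis imageI)
  qed
  show "replicate n 0 \<notin> ?Q"
  proof
    assume "replicate n 0 \<in> ?Q"
    then obtain c where c: "c \<in> set (cols N')" "list_of_vec c = replicate n 0" by force
    have "c = 0\<^sub>v n"
    proof (rule eq_vecI)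
      show "dim_vec c = dim_vec (0\<^sub>v n)" using vecs[OF c(1)] by (auto simp: vecs_def)
      fix i assume "i < dim_vec (0\<^sub>v n)"
      then show "c $ i = 0\<^sub>v n $ i" using list_of_vec_index[of c i] c(2) by simp
    qed
    then show False using zero c(1) by simp
  qed
qed

section \<open>Runs of the procedure\<close>

definition passes_step1 :: "nat mat set \<Rightarrow> bool" where
  "passes_step1 S \<longleftrightarrow> (\<forall>M\<in>S. \<forall>i<dim_row M. \<forall>i'<dim_row M. \<not> rows_separable M i i')"

text \<open>Each state records what the finished tests have established. While \<open>N'\<close> is
  being expanded, its original \<open>N\<close> is no longer in \<open>V\<close> and not part of the
  state, so it is quantified and excepted from the accepted matrices. The second reason for a
  positive decision also excludes empty matrices in \<open>U\<close>, as \<open>thin_closed\<close>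
  requires.\<close>

fun state_invariant :: "nat mat set \<Rightarrow> nat mat set \<Rightarrow> state \<Rightarrow> bool" where
  "state_invariant S U Step0 \<longleftrightarrow> True"
| "state_invariant S U Step1 \<longleftrightarrow> \<not> (\<exists>N\<in>U. empty_matrix N)"
| "state_invariant S U (Step1_Pairs P) \<longleftrightarrow> \<not> (\<exists>N\<in>U. empty_matrix N) \<and>
     \<not> (\<exists>M\<in>S. row_without_zero M) \<and> P \<subseteq> row_pairs S \<and>
     (\<forall>M i i'. (M, i, i') \<in> row_pairs S - P \<longrightarrow> \<not> rows_separable M i i')"
| "state_invariant S U (Step2 V) \<longleftrightarrow> passes_step1 S \<and> V \<subseteq> U \<and> (\<forall>N\<in>U - V. accepted S N)"
| "state_invariant S U (Expanding V k N') \<longleftrightarrow> passes_step1 S \<and> V \<subseteq> U \<and>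
     (\<exists>N\<in>U. \<exists>n m. N \<in> matr n m k \<and> (expansion S k)\<^sup>*\<^sup>* N N' \<and> (\<forall>N\<in>U - V - {N}. accepted S N))"
| "state_invariant S U Step3 \<longleftrightarrow> (\<forall>N\<in>U. accepted S N)"
| "state_invariant S U (Decision True) \<longleftrightarrow> (\<exists>M\<in>S. empty_matrix M) \<or>
     \<not> (\<exists>N\<in>U. empty_matrix N) \<and> \<not> passes_step1 S \<or> (\<forall>N\<in>U. accepted S N)"
| "state_invariant S U (Decision False) \<longleftrightarrow>
     \<not> (\<exists>M\<in>S. empty_matrix M) \<and> (\<exists>N\<in>U. empty_matrix N) \<or>
     passes_step1 S \<and> (\<exists>N\<in>U. \<exists>n m k N'. N \<in> matr n m k \<and> (expansion S k)\<^sup>*\<^sup>* N N' \<and>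
       (\<nexists>b. expansion_column S k N' b) \<and> 0\<^sub>v n \<notin> set (cols N'))"

lemma same_row_not_separable:
  assumes "\<not> row_without_zero M" and "i < dim_row M"
  shows "\<not> rows_separable M i i"
  using assms unfolding row_without_zero_def rows_separable_def by metis

lemma passes_step1I:
  assumes "\<not> (\<exists>M\<in>S. row_without_zero M)" and "\<And>M i i'. (M, i, i') \<in> row_pairs S \<Longrightarrow> \<not> rows_separable M i i'"
  shows "passes_step1 S"
  unfolding passes_step1_def
proof (intro ballI allI impI)
  fix M i i' assume "M \<in> S" "i < dim_row M" "i' < dim_row M"
  then show "\<not> rows_separable M i i'"
    using assms same_row_not_separable[of M i] by (cases "i = i'") (auto simp: row_pairs_def)
qed

text \<open>Either outcome of a linkage test settles separability of the two rows, a property in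
  which the chosen 0 does not occur; therefore the choice leaves no trace in the invariant.\<close>

lemma state_invariant_step:
  assumes "step S U s s'" and "state_invariant S U s"
  shows "state_invariant S U s'"
  using assms
proof (induction rule: step.induct)
  case step1_positive
  then obtain M where "M \<in> S" "row_without_zero M" by blast
  then have "\<not> passes_step1 S"
    unfolding passes_step1_def using row_without_zero_separable[of M] by metis
  then show ?case using step1_positive by simp
next
  case (pair_positive M i i' P j)
  then have M: "M \<in> S" "i < dim_row M" "i' < dim_row M" by (auto simp: row_pairs_def)
  then have "rows_separable M i i'"
    using pair_positive by (intro linkage_test_failure_separable)
  then have "\<not> passes_step1 S" using M unfolding passes_step1_def by blast
  then show ?case using pair_positive by simp
next
  case (pair_continue M i i' P j)
  then have "i \<noteq> i'" by (auto simp: row_pairs_def)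
  then have "\<not> rows_separable M i i'"
    using linkage_test_not_separable[OF pair_continue(3,4)] unfolding rows_separable_def by blast
  then show ?case using pair_continue by auto
next
  case pairs_done
  then show ?case using passes_step1I by simp
next
  case (step2_select N V n m k)
  then show ?case by auto
next
  case (expand k N b V)
  then obtain N0 n m where "N0 \<in> U" "N0 \<in> matr n m k" "(expansion S k)\<^sup>*\<^sup>* N0 N"
    "\<forall>N\<in>U - V - {N0}. accepted S N" by auto
  moreover have "expansion S k N (adjoin_column N b)" using expand unfolding expansion_def by blast
  ultimately have "N0 \<in> U" "N0 \<in> matr n m k" "(expansion S k)\<^sup>*\<^sup>* N0 (adjoin_column N b)"
    "\<forall>N\<in>U - V - {N0}. accepted S N" by (auto intro: rtranclp.rtrancl_into_rtrancl)
  then show ?case using expand by auto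
next
  case (expanded_negative k N V)
  then obtain N0 n m where N0: "N0 \<in> U" "N0 \<in> matr n m k" "(expansion S k)\<^sup>*\<^sup>* N0 N" by auto
  have "dim_row N = n" using expansions_cols[OF N0(3,2)] by blast
  then have "0\<^sub>v n \<notin> set (cols N)" using expanded_negative(2) by simp
  moreover have "passes_step1 S" using expanded_negative(3) by simp
  ultimately show ?case
    using N0 expanded_negative(1) unfolding state_invariant.simps by blast
next
  case (expanded_continue k N V)
  then obtain N0 n m where N0: "N0 \<in> U" "N0 \<in> matr n m k" "(expansion S k)\<^sup>*\<^sup>* N0 N"
    "\<forall>N\<in>U - V - {N0}. accepted S N" by auto
  have "dim_row N = n" using expansions_cols[OF N0(3,2)] by blast
  then have "accepted S N0" using N0 expanded_continue unfolding accepted_def by blast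
  then show ?case using N0 expanded_continue by auto
qed auto

lemma reachable_invariant: "reachable S U s \<Longrightarrow> state_invariant S U s"
  unfolding reachable_def
  by (induction rule: rtranclp_induct) (auto intro: state_invariant_step)

section \<open>Termination of all runs\<close>

lemma finite_row_pairs: "finite S \<Longrightarrow> finite (row_pairs S)"
  by (rule finite_subset[of _ "\<Union>M\<in>S. {M} \<times> {..<dim_row M} \<times> {..<dim_row M}"])
    (auto simp: row_pairs_def)

text \<open>Lexicographic: the phase, the matrices left, and the columns that can still be adjoined.
  Doubling with an extra 1 while expanding makes both selecting a matrix and returning from it
  decrease the second component.\<close>

fun state_measure :: "state \<Rightarrow> nat \<times> nat \<times> nat" where
  "state_measure Step0 = (5, 0, 0)"
| "state_measure Step1 = (4, 0, 0)"
| "state_measure (Step1_Pairs P) = (3, card P, 0)"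
| "state_measure (Step2 V) = (2, 2 * card V, 0)"
| "state_measure (Expanding V k N) = (2, 2 * card V + 1, card (vecs (dim_row N) k - set (cols N)))"
| "state_measure Step3 = (1, 0, 0)"
| "state_measure (Decision d) = (0, 0, 0)"

abbreviation "measure_less \<equiv> less_than <*lex*> less_than <*lex*> less_than"

lemma state_measure_step:
  assumes "finite S" and "finite U" and "step S U s s'" and "state_invariant S U s"
  shows "(state_measure s', state_measure s) \<in> measure_less"
  using assms(3,4)
proof (induction rule: step.induct)
  case (pair_continue M i i' P j)
  then have "finite P" using finite_row_pairs[OF assms(1)] finite_subset by auto
  then have "card (P - {(M, i, i')}) < card P" using pair_continue by (intro card_Diff1_less) auto
  then show ?case by simp
next
  case (step2_select N V n m k)
  then have "finite V" using assms(2) finite_subset by auto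
  then have "card (V - {N}) < card V" using step2_select by (intro card_Diff1_less) auto
  then show ?case by simp
next
  case (expand k N b V)
  note b = expand(1)
  have "b \<notin> set (cols N)" using b unfolding expansion_column_def by blast
  then have "card (vecs (dim_row N) k - set (cols N @ [b])) < card (vecs (dim_row N) k - set (cols N))"
    using expansion_column_vecs[OF b] finite_vecs by (intro psubset_card_mono) auto
  then show ?case using cols_adjoin_column[OF b] by simp
qed auto

lemma runs_finite:
  assumes "finite S" and "finite U"
  shows "\<not> (\<exists>s. s 0 = Step0 \<and> (\<forall>t. step S U (s t) (s (Suc t))))"
proof
  assume "\<exists>s. s 0 = Step0 \<and> (\<forall>t. step S U (s t) (s (Suc t)))"
  then obtain s where s: "s 0 = Step0" "\<And>t. step S U (s t) (s (Suc t))" by blast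
  have inv: "state_invariant S U (s t)" for t
  proof (induction t)
    case (Suc t)
    then show ?case using state_invariant_step[OF s(2)] by blast
  qed (simp add: s(1))
  have "\<forall>t. (state_measure (s (Suc t)), state_measure (s t)) \<in> measure_less"
    using state_measure_step[OF assms s(2) inv] by blast
  then have "\<exists>f. \<forall>t. (f (Suc t), f t) \<in> measure_less"
    by (rule exI[of _ "\<lambda>t. state_measure (s t)"])
  moreover have "wf measure_less" by (intro wf_lex_prod wf_less_than)
  ultimately show False unfolding wf_iff_no_infinite_down_chain by blast
qed

text \<open>A run could get stuck only for want of a choice: a 0 in the first row of a pair, which
  the invariant guarantees, or a bound \<open>k\<close> for a selected matrix, which
  \<open>matrix_set U\<close> provides.\<close>

lemma stuck_decision:
  assumes S: "matrix_set S" and U: "matrix_set U" and inv: "state_invariant S U s"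
    and stuck: "\<nexists>s'. step S U s s'"
  shows "\<exists>d. s = Decision d"
proof (cases s)
  case Step0
  then show ?thesis using stuck step0_positive step0_negative step0_continue by metis
next
  case Step1
  then show ?thesis using stuck step1_positive step1_continue by metis
next
  case (Step1_Pairs P)
  show ?thesis
  proof (cases "P = {}")
    case True
    then show ?thesis using stuck Step1_Pairs pairs_done by blast
  next
    case False
    then obtain M i i' where P: "(M, i, i') \<in> P" by auto
    then have "M \<in> S" "i < dim_row M" "\<not> row_without_zero M"
      using inv Step1_Pairs by (auto simp: row_pairs_def)
    then obtain j where "j < dim_col M" "M $$ (i, j) = 0" unfolding row_without_zero_def by blast
    then show ?thesis using stuck Step1_Pairs pair_positive[OF P] pair_continue[OF P] by blast
  qed
next
  case (Step2 V)
  show ?thesis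
  proof (cases "V = {}")
    case True
    then show ?thesis using stuck Step2 step2_done by blast
  next
    case False
    then obtain N where N: "N \<in> V" by blast
    then have "N \<in> U" using inv Step2 by auto
    then obtain n m k where "N \<in> matr n m k" using U unfolding matrix_set_def by blast
    then show ?thesis using stuck Step2 step2_select[OF N] by blast
  qed
next
  case (Expanding V k N)
  then show ?thesis using stuck expand expanded_negative expanded_continue by metis
next
  case Step3
  then show ?thesis using stuck step3 by blast
qed blast

section \<open>Correctness of the decisions\<close>

lemma positive_decision_sound:
  fixes C :: "('o, 'm) category_data"
  assumes S: "matrix_set S" and inv: "state_invariant S U (Decision True)" and C: "C \<in> mclex S"
  shows "C \<in> mclex U"
proof -
  have cat: "is_category C" and fc: "finitely_complete C"
    and closed: "\<And>M. M \<in> S \<Longrightarrow> has_closed_relations C M"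
    using C by (auto simp: mclex_def)
  have matr: "\<exists>n m k. M \<in> matr n m k" if "M \<in> S" for M
    using S that unfolding matrix_set_def by blast
  have "has_closed_relations C N" if N: "N \<in> U" for N
  proof -
    consider (empty) M where "M \<in> S" "empty_matrix M"
      | (sep) M i i' where "\<not> empty_matrix N" "M \<in> S" "i < dim_row M" "i' < dim_row M" "rows_separable M i i'"
      | (acc) "accepted S N"
      using inv N unfolding passes_step1_def state_invariant.simps by blast
    then show ?thesis
    proof cases
      case empty
      then show ?thesis using empty_matrix_closed[OF cat fc closed] matr by blast
    next
      case sep
      obtain n m k where M: "M \<in> matr n m k" using matr sep by blast
      then have d: "dim_row M = n" "dim_col M = m" by (auto simp: matr_def)
      obtain \<phi> \<psi> :: "nat \<Rightarrow> bool" where eq: "\<And>j. j < m \<Longrightarrow> \<phi> (M $$ (i, j)) = \<psi> (M $$ (i', j))"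
        and neq: "\<phi> 0 \<noteq> \<psi> 0"
        using sep(5) unfolding rows_separable_def d by blast
      have "f = g" if "f \<in> hom_set C X A" "g \<in> hom_set C X A" for X A f g
        by (rule separated_rows_thin[OF cat fc closed[OF sep(2)] M _ _ eq neq that])
          (use sep d in auto)
      then show ?thesis by (rule thin_closed[OF cat sep(1)])
    next
      case acc
      then show ?thesis by (rule accepted_closed[OF C])
    qed
  qed
  then show ?thesis using cat fc by (simp add: mclex_def)
qed

lemma negative_decision_sound:
  assumes S: "matrix_set S" and U: "matrix_set U" and inv: "state_invariant S U (Decision False)"
    and "infinite (UNIV :: 'o set)" and "infinite (UNIV :: 'm set)"
  shows "\<not> (mclex S :: ('o, 'm) category_data set) \<subseteq> mclex U"
proof -
  consider (empty) N where "\<not> (\<exists>M\<in>S. empty_matrix M)" "N \<in> U" "empty_matrix N"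
    | (rejected) N n m k N' where "passes_step1 S" "N \<in> U" "N \<in> matr n m k" "(expansion S k)\<^sup>*\<^sup>* N N'"
        "\<nexists>b. expansion_column S k N' b" "0\<^sub>v n \<notin> set (cols N')"
    using inv unfolding state_invariant.simps by blast
  then show ?thesis
  proof cases
    case empty
    have "has_closed_relations chain_cat M" if "M \<in> S" for M
      by (rule thin_closed[OF chain_is_category]) (use empty that in \<open>auto simp: chain_hom\<close>)
    then have "chain_cat \<in> mclex S"
      using chain_is_category chain_finitely_complete by (simp add: mclex_def)
    moreover obtain n m k where "N \<in> matr n m k" using U empty(2) unfolding matrix_set_def by blast
    then have "\<not> has_closed_relations chain_cat N" using empty(3) by (rule chain_not_closed)
    ultimately show ?thesis using separating_category[OF assms(4,5)] empty(2) by blast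
  next
    case rejected
    have sep: "\<not> rows_separable M i i'" if "M \<in> S" "i < dim_row M" "i' < dim_row M" for M i i'
      using rejected(1) that unfolding passes_step1_def by blast
    have n: "0 < n" using rejected(3) by (simp add: matr_def)
    have "finitely_complete (str_cat S n)"
      by (rule str_cat_finitely_complete, rule row_closed_tuples[OF _ n]) (use sep in blast)
    moreover have "has_closed_relations (str_cat S n) M" if "M \<in> S" for M
      by (rule str_cat_closed[OF _ n that]) (use sep in blast)
    ultimately have "str_cat S n \<in> mclex S" using str_cat_is_category by (simp add: mclex_def)
    moreover have "\<not> has_closed_relations (str_cat S n) N"
      by (rule rejected_not_closed[OF S _ rejected(3-6)]) (use sep in blast)
    ultimately show ?thesis using separating_category[OF assms(4,5)] rejected(2) by blast
  qed
qed

theorem mainTheorem3: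
  fixes S U :: "nat mat set"
  assumes "finite S" and "matrix_set S"
    and "finite U" and "matrix_set U"
  shows "procedure_terminates S U \<and>
    (reachable S U (Decision True) \<longrightarrow>
       (mclex S :: ('o, 'm) category_data set) \<subseteq> mclex U) \<and>
    (infinite (UNIV :: 'o set) \<longrightarrow> infinite (UNIV :: 'm set) \<longrightarrow>
       reachable S U (Decision False) \<longrightarrow>
       \<not> (mclex S :: ('o, 'm) category_data set) \<subseteq> mclex U)"
proof (intro conjI impI)
  show "procedure_terminates S U"
    unfolding procedure_terminates_def
    using runs_finite[OF assms(1,3)] stuck_decision[OF assms(2,4)] reachable_invariant by blast
next
  assume "reachable S U (Decision True)"
  then show "(mclex S :: ('o, 'm) category_data set) \<subseteq> mclex U"
    using positive_decision_sound[OF assms(2)] reachable_invariant by blast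
next
  assume "infinite (UNIV :: 'o set)" "infinite (UNIV :: 'm set)" "reachable S U (Decision False)"
  then show "\<not> (mclex S :: ('o, 'm) category_data set) \<subseteq> mclex U"
    using negative_decision_sound[OF assms(2,4)] reachable_invariant by blast
qed

end
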